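(* Let $\kappa$ be a regular uncountable ordinal and let $\alpha:=\min\mathrm{Class}(0)=\omega$. Then: 1. $\bigcap\{A^0(t): t\in[\kappa,\kappa\omega),\ T(0,\kappa,t)\cap\kappa\subset\alpha\}=\{\gamma\in\mathrm{Class}(0)\cap(\kappa+1):\gamma<_1\gamma\omega\}$. 2. $\{\gamma\in\mathrm{Class}(0):\gamma<_1\gamma\omega\}$ is closed unbounded in $\kappa$.
   Context: All variables range over ordinals; each ordinal is identified with the set of smaller ordinals, so for a set $S$ of ordinals and an ordinal $\beta$, $S\subset\beta$ means that all elements of $S$ are $<\beta$. Sums and products are ordinal operations. $\mathrm{Class}(0):=\mathbb{P}=\{\omega^\gamma:\gamma>0\}$ is the class of additive principal ordinals. $\mathrm{Lim}$ is the class of limit ordinals (nonzero), and for a class $A$ of ordinals, $\mathrm{Lim}\,A:=\{\alpha\neq 0:\alpha=\sup(A\cap\alpha)\}$. For $\alpha\le\beta$, $-\alpha+\beta$ is the unique $\sigma$ with $\alpha+\sigma=\beta$. A class $C$ of ordinals is called closed unbounded in $\kappa$ if $C\cap\kappa$ is a closed unbounded subset of $\kappa$. The relation $<_1$. By recursion on $\beta$: $\alpha<_1\beta$ iff $\alpha<\beta$ and for every finite $Z\subset\beta$ there are a finite $\tilde Z\subset\alpha$ and a bijection $h:Z\to\tilde Z$ with $h(x)=x$ for all $x\in Z\cap\alpha$ such that for all $a_1,a_2\in Z$: $a_1<a_2\Leftrightarrow h(a_1)<h(a_2)$; $a_1<_1a_2\Leftrightarrow h(a_1)<_1h(a_2)$;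 $a_1+a_2\in Z\Leftrightarrow h(a_1)+h(a_2)\in\tilde Z$; and if $a_1+a_2\in Z$ then $h(a_1+a_2)=h(a_1)+h(a_2)$. The sets $T$. For $\alpha\in\mathrm{Class}(0)$ and $t<\alpha\omega$: $T(0,\alpha,t):=\{t\}$ if $t<\alpha$, and $T(0,\alpha,t):=\{t,-\alpha n+t\}$ if $t\in[\alpha n,\alpha n+\alpha)$ with $n\in[1,\omega)$. The classes $A^0(t)$. For $t\ge\omega$ let $\alpha\in\mathrm{Class}(0)$ be the unique one with $t\in[\alpha,\alpha\omega)$. By recursion on $t$: - if $t=\alpha$: $A^0(t):=(\mathrm{Lim}\,\mathrm{Class}(0))\cap(\alpha+1)$; - if $t=l+1$: $A^0(t):=\mathrm{Lim}\,A^0(l)$; - if $t\in(\alpha,\alpha\omega)\cap\mathrm{Lim}$: $A^0(t):=\mathrm{Lim}\{r\in\mathrm{Class}(0)\cap(\alpha+1): T(0,\alpha,t)\cap\alpha\subset r \text{ and } r\in A^0(s)\text{ for every } s\in(\alpha,t)\text{ with }T(0,\alpha,s)\cap\alpha\subset r\}$. *)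

theory Defs
  imports Main "HOL-Library.Countable_Set"
begin

text \<open>
  HOL has no type of all ordinals.  The type \<open>'a ordinal\<close> consists of the order types of all
  well-orders whose field is a subset of \<open>'a + nat\<close>, i.e. of all ordinals below the cardinal
  successor of the infinite cardinal of \<open>'a + nat\<close>.  As \<open>'a\<close> is arbitrary, every ordinal \<open>\<kappa>\<close>
  available in HOL occurs in such a type, together with all ordinals of the same cardinality.
  The type is closed under suprema of families indexed by ordinals (lemma \<open>bdd_above_image_less\<close>
  below), hence under the ordinal operations.
\<close>

unbundle cardinal_syntax

quotient_type 'a ordinal = "('a + nat) rel" / partial: "\<lambda>r s. r =o s"
proof (rule part_equivpI)
  show "\<exists>r::('a + nat) rel. r =o r"
    using card_of_refl by blast
  show "symp (\<lambda>r s::('a + nat) rel. r =o s)"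
    by (auto intro: sympI ordIso_symmetric)
  show "transp (\<lambda>r s::('a + nat) rel. r =o s)"
    by (auto intro: transpI ordIso_transitive)
qed

lemma Well_order_if_ordIso: "r =o r \<longleftrightarrow> Well_order r"
  using ordIso_reflexive[of r] by (auto simp: ordIso_def)

instantiation ordinal :: (type) wellorder
begin

lift_definition less_eq_ordinal :: "'a ordinal \<Rightarrow> 'a ordinal \<Rightarrow> bool" is "\<lambda>r s. r \<le>o s"
  by (meson ordIso_ordLeq_trans ordIso_symmetric ordLeq_ordIso_trans)

lift_definition less_ordinal :: "'a ordinal \<Rightarrow> 'a ordinal \<Rightarrow> bool" is "\<lambda>r s. r <o s"
  by (meson ordIso_ordLess_trans ordIso_symmetric ordLess_ordIso_trans)

instance
proof
  fix x y z :: "'a ordinal"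
  show "x < y \<longleftrightarrow> x \<le> y \<and> \<not> y \<le> x"
    by transfer (metis Well_order_if_ordIso not_ordLeq_iff_ordLess ordLess_imp_ordLeq not_ordLess_ordLeq)
  show "x \<le> x"
    by transfer (simp add: ordIso_imp_ordLeq)
  show "x \<le> y \<Longrightarrow> y \<le> z \<Longrightarrow> x \<le> z"
    by transfer (rule ordLeq_transitive)
  show "x \<le> y \<Longrightarrow> y \<le> x \<Longrightarrow> x = y"
    by transfer (simp add: ordIso_iff_ordLeq)
  show "x \<le> y \<or> y \<le> x"
    by transfer (simp add: Well_order_if_ordIso ordLeq_total)
next
  fix P :: "'a ordinal \<Rightarrow> bool" and x
  assume step: "\<And>x. (\<And>y. y < x \<Longrightarrow> P y) \<Longrightarrow> P x"
  have "wf {(x, y :: 'a ordinal). x < y}"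
  proof (rule wf_subset)
    show "wf (inv_image (ordLess :: (('a + nat) rel \<times> ('a + nat) rel) set) rep_ordinal)"
      by (intro wf_inv_image wf_ordLess)
    show "{(x, y :: 'a ordinal). x < y} \<subseteq> inv_image ordLess rep_ordinal"
      by (auto simp: less_ordinal_def)
  qed
  then show "P x"
    by (induction x rule: wf_induct_rule) (auto intro: step)
qed

end

instantiation ordinal :: (type) conditionally_complete_linorder
begin

definition inf_ordinal :: "'a ordinal \<Rightarrow> 'a ordinal \<Rightarrow> 'a ordinal" where "inf_ordinal = min"
definition sup_ordinal :: "'a ordinal \<Rightarrow> 'a ordinal \<Rightarrow> 'a ordinal" where "sup_ordinal = max"
definition Inf_ordinal :: "'a ordinal set \<Rightarrow> 'a ordinal" where "Inf (S :: 'a ordinal set) = (LEAST x. x \<in> S)"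
definition Sup_ordinal :: "'a ordinal set \<Rightarrow> 'a ordinal" where "Sup (S :: 'a ordinal set) = (LEAST x. \<forall>s\<in>S. s \<le> x)"

instance
proof
  fix x z :: "'a ordinal" and X :: "'a ordinal set"
  show "Inf X \<le> x" if "x \<in> X"
    using that by (simp add: Inf_ordinal_def Least_le)
  show "z \<le> Inf X" if "X \<noteq> {}" "\<And>x. x \<in> X \<Longrightarrow> z \<le> x"
    using that unfolding Inf_ordinal_def ex_in_conv[symmetric] by (rule LeastI2_ex)
  show "x \<le> Sup X" if X: "x \<in> X" "bdd_above X"
  proof -
    obtain b where "\<forall>s\<in>X. s \<le> b"
      using X(2) by (auto simp: bdd_above_def)
    then have "\<forall>s\<in>X. s \<le> Sup X"
      unfolding Sup_ordinal_def by (rule LeastI)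
    with X show ?thesis by blast
  qed
  show "Sup X \<le> z" if "\<And>x. x \<in> X \<Longrightarrow> x \<le> z"
    using that by (auto simp: Sup_ordinal_def intro: Least_le)
qed (auto simp: inf_ordinal_def sup_ordinal_def)

end

lemma ordinal_abs_cases:
  obtains r where "x = abs_ordinal r" "Well_order r"
proof
  show "x = abs_ordinal (rep_ordinal x)"
    by (rule Quotient3_abs_rep[OF Quotient3_ordinal, symmetric])
  show "Well_order (rep_ordinal x)"
    using Quotient3_rep_reflp[OF Quotient3_ordinal, of x] by (simp only: Well_order_if_ordIso)
qed

lemma ordinal_less_abs:
  fixes r :: "('a + nat) rel"
  assumes "Well_order r"
  shows "{..<abs_ordinal r} = (\<lambda>a. abs_ordinal (Restr r (underS r a))) ` Field r"
proof -
  have W: "Well_order (Restr r (underS r a))" for a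
    by (simp add: Well_order_Restr assms)
  have abs_less: "abs_ordinal s < abs_ordinal r \<longleftrightarrow> s <o r" if "Well_order s" for s
    using that assms by (simp add: less_ordinal.abs_eq Well_order_if_ordIso)
  show ?thesis
  proof (intro equalityI subsetI)
    fix x assume "x \<in> {..<abs_ordinal r}"
    moreover obtain s where s: "x = abs_ordinal s" "Well_order s"
      by (rule ordinal_abs_cases)
    ultimately have "s <o r"
      using abs_less by auto
    then obtain a where a: "a \<in> Field r" "s =o Restr r (underS r a)"
      using ordLess_iff_ordIso_Restr[OF assms s(2)] by blast
    then have "abs_ordinal s = abs_ordinal (Restr r (underS r a))"
      using Quotient3_rel_abs[OF Quotient3_ordinal] by blast
    then show "x \<in> (\<lambda>a. abs_ordinal (Restr r (underS r a))) ` Field r"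
      using a s by blast
  next
    fix x assume "x \<in> (\<lambda>a. abs_ordinal (Restr r (underS r a))) ` Field r"
    then show "x \<in> {..<abs_ordinal r}"
      using abs_less[OF W] underS_Restr_ordLess[OF assms] by fastforce
  qed
qed

lemma card_ordinal_less: "|{..<x::'a ordinal}| \<le>o |UNIV::('a + nat) set|"
proof -
  obtain r where r: "x = abs_ordinal r" "Well_order r"
    by (rule ordinal_abs_cases)
  have "|{..<x}| \<le>o |Field r|"
    unfolding r ordinal_less_abs[OF r(2)] by (rule card_of_image)
  also have "|Field r| \<le>o |UNIV::('a + nat) set|"
    by (rule card_of_mono1) simp
  finally show ?thesis .
qed

lemma card_UNIV_ordinal: "\<not> |UNIV::'a ordinal set| \<le>o |UNIV::('a + nat) set|"
proof
  assume "|UNIV::'a ordinal set| \<le>o |UNIV::('a + nat) set|"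
  then obtain e :: "'a ordinal \<Rightarrow> 'a + nat" where e: "inj e"
    by (auto simp: card_of_ordLeq[symmetric])
  define R where "R = {(x, y :: 'a ordinal). x \<le> y}"
  have FR: "Field R = UNIV"
    by (auto simp: R_def Field_def)
  have "Well_order R"
    unfolding well_order_on_def linear_order_on_def partial_order_on_def preorder_on_def FR
  proof (intro conjI)
    have "R - Id = {(x, y). x < y}" by (auto simp: R_def)
    then show "wf (R - Id)" by (simp only: wf)
  qed (auto simp: R_def refl_on_def antisym_def total_on_def intro: transI)
  define r where "r = dir_image R e"
  have r: "Well_order r"
    unfolding r_def using \<open>Well_order R\<close> e FR by (simp add: Well_order_dir_image)
  have Fr: "Field r = range e"
    by (simp add: r_def dir_image_Field FR)
  define g where "g x = abs_ordinal (Restr r (underS r (e x)))" for x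
  have g_less: "g x < abs_ordinal r" for x
    using ordinal_less_abs[OF r] Fr unfolding g_def by blast
  have g_mono: "g x < g y" if "x < y" for x y
  proof -
    have u: "underS r (e x) = e ` {..<x}" for x
      by (auto simp: underS_def r_def dir_image_def R_def inj_eq[OF e] less_le)
    have "underS r (e x) \<subset> underS r (e y)"
      unfolding u using that e
      by (intro image_strict_mono) (auto simp: lessThan_strict_subset_iff intro: inj_on_subset)
    moreover have "wo_rel.ofilter r (underS r a)" for a
      using r by (simp add: wo_rel_def wo_rel.underS_ofilter)
    ultimately have "Restr r (underS r (e x)) <o Restr r (underS r (e y))"
      using ofilter_subset_ordLess[OF r] by blast
    then show ?thesis
      unfolding g_def by (simp add: less_ordinal.abs_eq Well_order_if_ordIso Well_order_Restr r)
  qed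
  have "x \<le> g x" for x
  proof (induction x rule: less_induct)
    case (less x)
    show ?case
    proof (rule ccontr)
      assume "\<not> x \<le> g x"
      then have "g x < x" by simp
      then show False
        using less[of "g x"] g_mono[of "g x" x] by simp
    qed
  qed
  then show False
    using g_less[of "abs_ordinal r"] by (simp add: leD)
qed

lemma bdd_above_image_less:
  fixes f :: "'a ordinal \<Rightarrow> 'a ordinal"
  shows "bdd_above (f ` {..<x})"
proof (rule ccontr)
  assume "\<not> bdd_above (f ` {..<x})"
  then have "\<exists>y\<in>{..<x}. z < f y" for z
    by (metis bdd_above.I2 linorder_not_le)
  then have "(\<Union>y\<in>{..<x}. {..<f y}) = UNIV"
    by auto
  moreover have "|\<Union>y\<in>{..<x}. {..<f y}| \<le>o |UNIV::('a + nat) set|"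
    by (rule card_of_UNION_ordLeq_infinite)
      (auto simp: card_ordinal_less finite_Plus_UNIV_iff)
  ultimately show False
    using card_UNIV_ordinal by metis
qed

lemma ordinal_no_greatest: "\<exists>y. (x::'a ordinal) < y"
proof (rule ccontr)
  assume "\<nexists>y. x < y"
  then have "UNIV = {..<x} \<union> {x}"
    by (auto simp: not_less_iff_gr_or_eq)
  moreover have "|{..<x} \<union> {x}| \<le>o |UNIV::('a + nat) set|"
    by (rule card_of_Un_ordLeq_infinite_Field[OF _ _ _ card_of_Card_order])
      (simp_all add: card_ordinal_less card_of_singl_ordLeq finite_Plus_UNIV_iff Field_card_of)
  ultimately show False
    using card_UNIV_ordinal by metis
qed

lemma strict_bound_image_less:
  fixes f :: "'a ordinal \<Rightarrow> 'a ordinal"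
  shows "\<exists>b\<ge>a. \<forall>y<x. f y < b"
proof -
  obtain b where "\<forall>y<x. f y \<le> b"
    using bdd_above_image_less[of f x] by (auto simp: bdd_above_def)
  moreover obtain c where "max a b < c"
    using ordinal_no_greatest by blast
  ultimately show ?thesis
    by (intro exI[of _ c]) (auto intro: le_less_trans)
qed

instantiation ordinal :: (type) "{zero, one, plus, times}"
begin

definition zero_ordinal :: "'a ordinal" where "0 = (LEAST x :: 'a ordinal. True)"

definition one_ordinal :: "'a ordinal" where "1 = (LEAST x :: 'a ordinal. 0 < x)"

function plus_ordinal :: "'a ordinal \<Rightarrow> 'a ordinal \<Rightarrow> 'a ordinal" where
  "plus_ordinal \<alpha> \<beta> = (LEAST \<delta>. \<alpha> \<le> \<delta> \<and> (\<forall>\<gamma><\<beta>. plus_ordinal \<alpha> \<gamma> < \<delta>))"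
  by pat_completeness auto
termination
  by (relation "inv_image {(x, y). x < y} snd") (rule wf_inv_image[OF wf], simp)

declare plus_ordinal.simps [simp del]

function times_ordinal :: "'a ordinal \<Rightarrow> 'a ordinal \<Rightarrow> 'a ordinal" where
  "times_ordinal \<alpha> \<beta> = Sup ((\<lambda>\<gamma>. times_ordinal \<alpha> \<gamma> + \<alpha>) ` {..<\<beta>})"
  by pat_completeness auto
termination
  by (relation "inv_image {(x, y). x < y} snd") (rule wf_inv_image[OF wf], simp)

declare times_ordinal.simps [simp del]

instance ..

end

definition limit_ordinal :: "'a ordinal \<Rightarrow> bool" where
  "limit_ordinal \<alpha> \<longleftrightarrow> \<alpha> \<noteq> 0 \<and> (\<nexists>\<beta>. \<alpha> = \<beta> + 1)"

definition omega :: "'a ordinal" (\<open>\<omega>\<close>) where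
  "\<omega> = (LEAST \<alpha>. limit_ordinal \<alpha>)"

text \<open>
  The following lemmas show that the recursive definitions of sums, products and powers of \<open>\<omega>\<close>
  agree with the usual equations for zero, successors and limits.
\<close>

lemma ordinal_zero_le [simp]: "0 \<le> (\<alpha>::'a ordinal)"
  unfolding zero_ordinal_def by (rule Least_le) simp

lemma ordinal_not_less_zero [simp]: "\<not> (\<alpha>::'a ordinal) < 0"
  by (simp add: not_less)

lemma ordinal_less_one_iff [simp]: "(\<alpha>::'a ordinal) < 1 \<longleftrightarrow> \<alpha> = 0"
proof -
  have "(0::'a ordinal) < 1"
    unfolding one_ordinal_def by (rule LeastI_ex) (rule ordinal_no_greatest)
  moreover have "1 \<le> \<alpha>" if "0 < \<alpha>"
    using that unfolding one_ordinal_def by (rule Least_le)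
  ultimately show ?thesis
    by (metis leD less_le ordinal_zero_le)
qed

lemma ordinal_add_props:
  fixes \<alpha> \<beta> :: "'a ordinal"
  shows "\<alpha> \<le> \<alpha> + \<beta>" "\<gamma> < \<beta> \<Longrightarrow> \<alpha> + \<gamma> < \<alpha> + \<beta>"
    and "\<alpha> \<le> \<delta> \<Longrightarrow> (\<And>\<gamma>. \<gamma> < \<beta> \<Longrightarrow> \<alpha> + \<gamma> < \<delta>) \<Longrightarrow> \<alpha> + \<beta> \<le> \<delta>"
proof -
  have "\<alpha> \<le> \<alpha> + \<beta> \<and> (\<forall>\<gamma><\<beta>. \<alpha> + \<gamma> < \<alpha> + \<beta>)"
    unfolding plus_ordinal.simps[of \<alpha> \<beta>] by (rule LeastI_ex) (rule strict_bound_image_less)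
  then show "\<alpha> \<le> \<alpha> + \<beta>" "\<gamma> < \<beta> \<Longrightarrow> \<alpha> + \<gamma> < \<alpha> + \<beta>" by auto
  show "\<alpha> + \<beta> \<le> \<delta>" if "\<alpha> \<le> \<delta>" "\<And>\<gamma>. \<gamma> < \<beta> \<Longrightarrow> \<alpha> + \<gamma> < \<delta>"
    unfolding plus_ordinal.simps[of \<alpha> \<beta>] by (rule Least_le) (use that in auto)
qed

lemma ordinal_add_zero [simp]: "(\<alpha>::'a ordinal) + 0 = \<alpha>"
  by (intro antisym ordinal_add_props) auto

lemma ordinal_less_add_one [simp]: "(\<alpha>::'a ordinal) < \<beta> + 1 \<longleftrightarrow> \<alpha> \<le> \<beta>"
proof
  have "\<beta> + 0 < \<beta> + 1"
    by (rule ordinal_add_props) simp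
  then show "\<alpha> \<le> \<beta> \<Longrightarrow> \<alpha> < \<beta> + 1" by simp
  have "\<beta> + 1 \<le> \<alpha>" if "\<beta> < \<alpha>"
    using that by (intro ordinal_add_props) auto
  then show "\<alpha> < \<beta> + 1 \<Longrightarrow> \<alpha> \<le> \<beta>"
    by (meson leD linorder_le_less_linear)
qed

lemma ordinal_add_one_le [simp]: "(\<beta>::'a ordinal) + 1 \<le> \<alpha> \<longleftrightarrow> \<beta> < \<alpha>"
  by (metis not_le ordinal_less_add_one)

lemma ordinal_add_one_inject [simp]: "(\<alpha>::'a ordinal) + 1 = \<beta> + 1 \<longleftrightarrow> \<alpha> = \<beta>"
proof
  assume eq: "\<alpha> + 1 = \<beta> + 1"
  have "\<alpha> < \<alpha> + 1" "\<beta> < \<beta> + 1" by simp_all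
  then have "\<alpha> < \<beta> + 1" "\<beta> < \<alpha> + 1" by (simp_all only: eq)
  then show "\<alpha> = \<beta>" by simp
qed simp

lemma ordinal_add_one_neq_zero [simp]: "(\<alpha>::'a ordinal) + 1 \<noteq> 0"
proof
  assume "\<alpha> + 1 = 0"
  moreover have "\<alpha> < \<alpha> + 1" by simp
  ultimately show False by simp
qed

lemma ordinal_zero_add_one [simp]: "0 + 1 = (1::'a ordinal)"
proof (rule antisym)
  show "0 + 1 \<le> (1::'a ordinal)" by simp
  show "1 \<le> (0 + 1 :: 'a ordinal)"
    by (rule leI) simp
qed

lemma ordinal_add_succ: "(\<alpha>::'a ordinal) + (\<beta> + 1) = (\<alpha> + \<beta>) + 1"
proof (rule antisym)
  show "\<alpha> + \<beta> + 1 \<le> \<alpha> + (\<beta> + 1)"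
    by (simp add: ordinal_add_props)
  show "\<alpha> + (\<beta> + 1) \<le> \<alpha> + \<beta> + 1"
  proof (rule ordinal_add_props(3))
    show "\<alpha> \<le> \<alpha> + \<beta> + 1"
      using ordinal_add_props(1) by (metis less_imp_le ordinal_less_add_one)
    show "\<alpha> + \<gamma> < \<alpha> + \<beta> + 1" if "\<gamma> < \<beta> + 1" for \<gamma>
      using that ordinal_add_props(2)[of \<gamma> \<beta> \<alpha>] by (auto simp: le_less)
  qed
qed

lemma ordinal_add_limit:
  assumes "limit_ordinal \<beta>"
  shows "\<alpha> + \<beta> = Sup ((\<lambda>\<gamma>. \<alpha> + \<gamma>) ` {..<\<beta>})"
proof (rule antisym)
  have pos: "0 < \<beta>"
    using assms by (metis limit_ordinal_def less_le ordinal_zero_le)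
  have succ: "\<gamma> + 1 < \<beta>" if "\<gamma> < \<beta>" for \<gamma>
    using that assms by (metis limit_ordinal_def less_le ordinal_add_one_le)
  have up: "\<alpha> + \<gamma> \<le> Sup ((\<lambda>\<gamma>. \<alpha> + \<gamma>) ` {..<\<beta>})" if "\<gamma> < \<beta>" for \<gamma>
    using that by (intro cSup_upper bdd_above_image_less) auto
  show "Sup ((\<lambda>\<gamma>. \<alpha> + \<gamma>) ` {..<\<beta>}) \<le> \<alpha> + \<beta>"
    using pos by (intro cSup_least) (auto intro: less_imp_le ordinal_add_props)
  show "\<alpha> + \<beta> \<le> Sup ((\<lambda>\<gamma>. \<alpha> + \<gamma>) ` {..<\<beta>})"
  proof (rule ordinal_add_props)
    show "\<alpha> \<le> Sup ((\<lambda>\<gamma>. \<alpha> + \<gamma>) ` {..<\<beta>})"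
      using up[OF pos] by simp
    fix \<gamma> assume "\<gamma> < \<beta>"
    then have "(\<alpha> + \<gamma>) + 1 \<le> Sup ((\<lambda>\<gamma>. \<alpha> + \<gamma>) ` {..<\<beta>})"
      using up[OF succ] by (simp only: ordinal_add_succ)
    then show "\<alpha> + \<gamma> < Sup ((\<lambda>\<gamma>. \<alpha> + \<gamma>) ` {..<\<beta>})" by simp
  qed
qed

lemma ordinal_Sup_empty [simp]: "Sup ({} :: 'a ordinal set) = 0"
  by (simp add: Sup_ordinal_def zero_ordinal_def)

lemma ordinal_Sup_mono_less:
  fixes f :: "'a ordinal \<Rightarrow> 'a ordinal"
  assumes "\<alpha> \<le> \<beta>"
  shows "Sup (f ` {..<\<alpha>}) \<le> Sup (f ` {..<\<beta>})"
proof (cases "{..<\<alpha>} = {}")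
  case False
  then show ?thesis
    using assms by (intro cSup_subset_mono bdd_above_image_less) auto
next
  case True
  then show ?thesis by simp
qed

lemma ordinal_mult_zero: "(\<alpha>::'a ordinal) * 0 = 0"
proof -
  have "{..<0::'a ordinal} = {}"
    by auto
  then show ?thesis by (simp add: times_ordinal.simps[of \<alpha> 0])
qed

lemma ordinal_mult_mono: "\<beta> \<le> \<gamma> \<Longrightarrow> (\<alpha>::'a ordinal) * \<beta> \<le> \<alpha> * \<gamma>"
  unfolding times_ordinal.simps[of \<alpha> \<beta>] times_ordinal.simps[of \<alpha> \<gamma>]
  by (rule ordinal_Sup_mono_less)

lemma ordinal_add_mono_left: "\<beta> \<le> \<gamma> \<Longrightarrow> (\<beta>::'a ordinal) + \<alpha> \<le> \<gamma> + \<alpha>"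
proof (induction \<alpha> rule: less_induct)
  case (less \<alpha>)
  show ?case
  proof (rule ordinal_add_props)
    show "\<beta> \<le> \<gamma> + \<alpha>"
      using less.prems ordinal_add_props(1) by (rule order_trans)
    show "\<beta> + \<delta> < \<gamma> + \<alpha>" if "\<delta> < \<alpha>" for \<delta>
      using less.IH[OF that less.prems] ordinal_add_props(2)[OF that] by (rule le_less_trans)
  qed
qed

lemma ordinal_mult_succ: "(\<alpha>::'a ordinal) * (\<beta> + 1) = \<alpha> * \<beta> + \<alpha>"
  unfolding times_ordinal.simps[of \<alpha> "\<beta> + 1"]
  by (rule cSup_eq_maximum) (auto intro!: ordinal_add_mono_left ordinal_mult_mono)

lemma ordinal_mult_limit:
  assumes "limit_ordinal \<beta>"
  shows "\<alpha> * \<beta> = Sup ((\<lambda>\<gamma>. \<alpha> * \<gamma>) ` {..<\<beta>})"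
proof (rule antisym)
  have pos: "0 < \<beta>"
    using assms by (metis limit_ordinal_def less_le ordinal_zero_le)
  have succ: "\<gamma> + 1 < \<beta>" if "\<gamma> < \<beta>" for \<gamma>
    using that assms by (metis limit_ordinal_def less_le ordinal_add_one_le)
  show "Sup ((\<lambda>\<gamma>. \<alpha> * \<gamma>) ` {..<\<beta>}) \<le> \<alpha> * \<beta>"
    using pos by (intro cSup_least) (auto intro: less_imp_le ordinal_mult_mono)
  show "\<alpha> * \<beta> \<le> Sup ((\<lambda>\<gamma>. \<alpha> * \<gamma>) ` {..<\<beta>})"
    unfolding times_ordinal.simps[of \<alpha> \<beta>]
  proof (rule cSup_least)
    fix x assume "x \<in> (\<lambda>\<gamma>. \<alpha> * \<gamma> + \<alpha>) ` {..<\<beta>}"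
    then obtain \<gamma> where \<gamma>: "\<gamma> < \<beta>" "x = \<alpha> * (\<gamma> + 1)"
      by (auto simp: ordinal_mult_succ)
    show "x \<le> Sup ((\<lambda>\<gamma>. \<alpha> * \<gamma>) ` {..<\<beta>})"
      unfolding \<gamma> using succ[OF \<gamma>(1)] by (intro cSup_upper bdd_above_image_less) auto
  qed (use pos in auto)
qed

lemma ex_limit_ordinal: "\<exists>\<alpha>::'a ordinal. limit_ordinal \<alpha>"
proof (rule ccontr)
  assume no: "\<nexists>\<alpha>::'a ordinal. limit_ordinal \<alpha>"
  define f :: "nat \<Rightarrow> 'a ordinal" where "f n = ((\<lambda>\<beta>. \<beta> + 1) ^^ n) 0" for n
  have "\<alpha> \<in> range f" for \<alpha>
  proof (induction \<alpha> rule: less_induct)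
    case (less \<alpha>)
    show ?case
    proof (cases "\<alpha> = 0")
      case True
      then show ?thesis by (auto simp: f_def intro: rev_image_eqI[of 0])
    next
      case False
      then obtain \<beta> where \<beta>: "\<alpha> = \<beta> + 1"
        using no unfolding limit_ordinal_def by blast
      then obtain n where "\<beta> = f n"
        using less.IH[of \<beta>] by auto
      then have "\<alpha> = f (Suc n)"
        by (simp add: \<beta> f_def)
      then show ?thesis by blast
    qed
  qed
  then have "|UNIV :: 'a ordinal set| \<le>o |UNIV :: nat set|"
    using card_of_image[of f UNIV] by (metis UNIV_eq_I)
  also have "|UNIV :: nat set| \<le>o |UNIV :: ('a + nat) set|"
    using card_of_ordLeq[of UNIV UNIV] inj_Inr by blast
  finally show False
    using card_UNIV_ordinal by blast
qed

lemma limit_ordinal_omega: "limit_ordinal \<omega>"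
  unfolding omega_def by (rule LeastI_ex) (rule ex_limit_ordinal)

function omega_pow :: "'a ordinal \<Rightarrow> 'a ordinal" where
  "omega_pow \<beta> = Sup (insert 1 ((\<lambda>\<gamma>. omega_pow \<gamma> * \<omega>) ` {..<\<beta>}))"
  by pat_completeness auto
termination
  by (relation "{(x, y). x < y}") (rule wf, simp)

declare omega_pow.simps [simp del]

lemma ordinal_mult_mono_left: "\<alpha> \<le> \<beta> \<Longrightarrow> (\<alpha>::'a ordinal) * \<gamma> \<le> \<beta> * \<gamma>"
proof (induction \<gamma> rule: less_induct)
  case (less \<gamma>)
  show ?case
    unfolding times_ordinal.simps[of \<alpha> \<gamma>]
  proof (cases "\<gamma> = 0")
    case False
    then have "0 < \<gamma>" by (metis less_le ordinal_zero_le)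
    show "Sup ((\<lambda>\<delta>. \<alpha> * \<delta> + \<alpha>) ` {..<\<gamma>}) \<le> \<beta> * \<gamma>"
    proof (rule cSup_least)
      fix x assume "x \<in> (\<lambda>\<delta>. \<alpha> * \<delta> + \<alpha>) ` {..<\<gamma>}"
      then obtain \<delta> where \<delta>: "\<delta> < \<gamma>" "x = \<alpha> * \<delta> + \<alpha>" by auto
      have "x \<le> \<beta> * \<delta> + \<alpha>"
        unfolding \<delta> by (intro ordinal_add_mono_left less \<delta>)
      also have "\<dots> \<le> \<beta> * \<delta> + \<beta>"
        using less.prems ordinal_add_props(2) by (metis le_less)
      also have "\<dots> = \<beta> * (\<delta> + 1)"
        by (simp add: ordinal_mult_succ)
      also have "\<dots> \<le> \<beta> * \<gamma>"
        by (rule ordinal_mult_mono) (simp add: \<delta>)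
      finally show "x \<le> \<beta> * \<gamma>" .
    qed (use \<open>0 < \<gamma>\<close> in auto)
  next
    case True
    then have "{..<\<gamma>} = {}" by auto
    then show "Sup ((\<lambda>\<delta>. \<alpha> * \<delta> + \<alpha>) ` {..<\<gamma>}) \<le> \<beta> * \<gamma>" by simp
  qed
qed

lemma ordinal_one_mult [simp]: "1 * (\<alpha>::'a ordinal) = \<alpha>"
proof (induction \<alpha> rule: less_induct)
  case (less \<alpha>)
  have "1 * \<alpha> = Sup ((\<lambda>\<gamma>. \<gamma> + 1) ` {..<\<alpha>})"
    unfolding times_ordinal.simps[of 1 \<alpha>] using less by (intro arg_cong[where f = Sup] image_cong) auto
  also have "\<dots> = \<alpha>"
    unfolding Sup_ordinal_def
  proof (rule Least_equality)
    show "\<alpha> \<le> y" if "\<forall>s\<in>(\<lambda>\<gamma>. \<gamma> + 1) ` {..<\<alpha>}. s \<le> y" for y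
      using that by (intro leI notI) auto
  qed auto
  finally show ?case .
qed

lemma bdd_above_omega_pow: "bdd_above (insert 1 ((\<lambda>\<gamma>. omega_pow \<gamma> * \<omega>) ` {..<\<beta>}))"
  by (metis bdd_above_image_less bdd_above_insert)

lemma one_le_omega_pow: "1 \<le> omega_pow \<beta>"
  unfolding omega_pow.simps[of \<beta>] by (rule cSup_upper) (use bdd_above_omega_pow in auto)

lemma omega_pow_mono: "\<alpha> \<le> \<beta> \<Longrightarrow> omega_pow \<alpha> \<le> omega_pow \<beta>"
  unfolding omega_pow.simps[of \<alpha>] omega_pow.simps[of \<beta>]
  by (intro cSup_subset_mono bdd_above_omega_pow) auto

lemma one_le_omega: "1 \<le> (\<omega> :: 'a ordinal)"
  using limit_ordinal_omega by (metis limit_ordinal_def not_le ordinal_less_one_iff)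

lemma omega_pow_zero: "omega_pow 0 = 1"
proof -
  have "{..<0::'a ordinal} = {}"
    by auto
  then show "omega_pow 0 = (1 :: 'a ordinal)" by (simp add: omega_pow.simps[of 0])
qed

lemma omega_pow_succ: "omega_pow (\<beta> + 1) = omega_pow \<beta> * \<omega>"
  unfolding omega_pow.simps[of "\<beta> + 1"]
proof (rule cSup_eq_maximum)
  fix x assume "x \<in> insert 1 ((\<lambda>\<gamma>. omega_pow \<gamma> * \<omega>) ` {..<\<beta> + 1})"
  moreover have "1 \<le> omega_pow \<beta> * \<omega>"
    using one_le_omega ordinal_mult_mono_left[OF one_le_omega_pow, of \<omega> \<beta>]
    by (metis order_trans ordinal_one_mult)
  ultimately show "x \<le> omega_pow \<beta> * \<omega>"
    using ordinal_mult_mono_left[OF omega_pow_mono] by auto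
qed auto

lemma omega_pow_limit:
  assumes "limit_ordinal \<beta>"
  shows "omega_pow \<beta> = Sup (omega_pow ` {..<\<beta>})"
proof (rule antisym)
  have pos: "0 < \<beta>"
    using assms by (metis limit_ordinal_def less_le ordinal_zero_le)
  have succ: "\<gamma> + 1 < \<beta>" if "\<gamma> < \<beta>" for \<gamma>
    using that assms by (metis limit_ordinal_def less_le ordinal_add_one_le)
  have up: "omega_pow \<gamma> \<le> Sup (omega_pow ` {..<\<beta>})" if "\<gamma> < \<beta>" for \<gamma>
    using that by (intro cSup_upper bdd_above_image_less) auto
  show "Sup (omega_pow ` {..<\<beta>}) \<le> omega_pow \<beta>"
    using pos by (intro cSup_least) (auto intro: less_imp_le omega_pow_mono)
  have "omega_pow \<gamma> * \<omega> \<le> Sup (omega_pow ` {..<\<beta>})" if "\<gamma> < \<beta>" for \<gamma>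
    using up[OF succ[OF that]] by (simp add: omega_pow_succ)
  moreover have "1 \<le> Sup (omega_pow ` {..<\<beta>})"
    using up[OF pos] by (simp add: omega_pow_zero)
  ultimately show "omega_pow \<beta> \<le> Sup (omega_pow ` {..<\<beta>})"
    unfolding omega_pow.simps[of \<beta>] by (intro cSup_least) auto
qed

text \<open>The minimum of \<open>Class0\<close> is \<open>\<omega>\<close>, see lemma \<open>Inf_Class0\<close> below.\<close>

definition Class0 :: "'a ordinal set" where
  "Class0 = {omega_pow \<gamma> |\<gamma>. 0 < \<gamma>}"

lemma Inf_Class0: "Inf Class0 = \<omega>"
proof (rule cInf_eq_minimum)
  have 1: "omega_pow 1 = (\<omega> :: 'a ordinal)"
    using omega_pow_succ[of "0 :: 'a ordinal"] ordinal_zero_add_one by (simp add: omega_pow_zero)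
  then show "(\<omega> :: 'a ordinal) \<in> Class0"
    unfolding Class0_def by (intro CollectI exI[of _ 1]) simp
  fix x :: "'a ordinal" assume "x \<in> Class0"
  then obtain \<gamma> where "0 < \<gamma>" "x = omega_pow \<gamma>"
    by (auto simp: Class0_def)
  then show "\<omega> \<le> x"
    unfolding 1[symmetric] by (metis less_le not_le omega_pow_mono ordinal_less_one_iff)
qed

definition Lim_pts :: "'a ordinal set \<Rightarrow> 'a ordinal set" where
  "Lim_pts A = {\<alpha>. \<alpha> \<noteq> 0 \<and> \<alpha> = Sup (A \<inter> {..<\<alpha>})}"

text \<open>The ordinal \<open>-\<alpha> + \<beta>\<close>, for \<open>\<alpha> \<le> \<beta>\<close>.\<close>

definition left_diff :: "'a ordinal \<Rightarrow> 'a ordinal \<Rightarrow> 'a ordinal" where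
  "left_diff \<alpha> \<beta> = (THE \<sigma>. \<alpha> + \<sigma> = \<beta>)"

definition cofinality :: "'a ordinal \<Rightarrow> 'a ordinal" where
  "cofinality \<alpha> = (LEAST \<beta>. \<exists>f. f ` {..<\<beta>} \<subseteq> {..<\<alpha>} \<and> (\<forall>\<xi><\<alpha>. \<exists>\<eta><\<beta>. \<xi> \<le> f \<eta>))"

definition regular_ordinal :: "'a ordinal \<Rightarrow> bool" where
  "regular_ordinal \<kappa> \<longleftrightarrow> limit_ordinal \<kappa> \<and> cofinality \<kappa> = \<kappa>"

definition closed_unbounded_in :: "'a ordinal set \<Rightarrow> 'a ordinal \<Rightarrow> bool" where
  "closed_unbounded_in C \<kappa> \<longleftrightarrow>
     (\<forall>S. S \<noteq> {} \<and> S \<subseteq> C \<inter> {..<\<kappa>} \<and> Sup S < \<kappa> \<longrightarrow> Sup S \<in> C) \<and>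
     (\<forall>\<beta><\<kappa>. \<exists>\<gamma>\<in>C \<inter> {..<\<kappa>}. \<beta> < \<gamma>)"

context
  notes conj_cong [fundef_cong]
begin

function less1 :: "'a ordinal \<Rightarrow> 'a ordinal \<Rightarrow> bool" (infix \<open><\<^sub>1\<close> 50) where
  "\<alpha> <\<^sub>1 \<beta> \<longleftrightarrow> \<alpha> < \<beta> \<and>
     (\<forall>Z. finite Z \<and> Z \<subseteq> {..<\<beta>} \<longrightarrow>
       (\<exists>Z' h. finite Z' \<and> Z' \<subseteq> {..<\<alpha>} \<and> bij_betw h Z Z' \<and> (\<forall>x\<in>Z \<inter> {..<\<alpha>}. h x = x) \<and>
         (\<forall>a\<^sub>1\<in>Z. \<forall>a\<^sub>2\<in>Z.
           (a\<^sub>1 < a\<^sub>2 \<longleftrightarrow> h a\<^sub>1 < h a\<^sub>2) \<and>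
           (a\<^sub>1 <\<^sub>1 a\<^sub>2 \<longleftrightarrow> h a\<^sub>1 <\<^sub>1 h a\<^sub>2) \<and>
           (a\<^sub>1 + a\<^sub>2 \<in> Z \<longleftrightarrow> h a\<^sub>1 + h a\<^sub>2 \<in> Z') \<and>
           (a\<^sub>1 + a\<^sub>2 \<in> Z \<longrightarrow> h (a\<^sub>1 + a\<^sub>2) = h a\<^sub>1 + h a\<^sub>2))))"
  by pat_completeness auto
termination
  by (relation "inv_image {(x, y). x < y} snd")
    (rule wf_inv_image[OF wf], auto dest: bij_betw_apply intro: less_trans)

end

declare less1.simps [simp del]

text \<open>\<open>T0 \<alpha> t\<close> is \<open>T(0, \<alpha>, t)\<close>.\<close>

definition T0 :: "'a ordinal \<Rightarrow> 'a ordinal \<Rightarrow> 'a ordinal set" where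
  "T0 \<alpha> t =
     (if t < \<alpha> then {t}
      else let n = (THE n. n \<in> {1..<\<omega>} \<and> t \<in> {\<alpha> * n..<\<alpha> * n + \<alpha>}) in {t, left_diff (\<alpha> * n) t})"

text \<open>\<open>lead t\<close> is the \<open>\<alpha> \<in> Class(0)\<close> with \<open>\<alpha> \<le> t < \<alpha>\<omega>\<close>, for \<open>t \<ge> \<omega>\<close>.\<close>

definition lead :: "'a ordinal \<Rightarrow> 'a ordinal" where
  "lead t = (THE \<alpha>. \<alpha> \<in> Class0 \<and> t \<in> {\<alpha>..<\<alpha> * \<omega>})"

text \<open>
  Only the values for \<open>t \<ge> \<omega>\<close> are meaningful.  In the last case \<open>t\<close> is a limit in \<open>(\<alpha>, \<alpha>\<omega>)\<close>.
\<close>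

function A0 :: "'a ordinal \<Rightarrow> 'a ordinal set" where
  "A0 t = (let \<alpha> = lead t in
     if t = \<alpha> then Lim_pts Class0 \<inter> {..<\<alpha> + 1}
     else if \<exists>l. t = l + 1 then Lim_pts (A0 (THE l. t = l + 1))
     else Lim_pts {r \<in> Class0 \<inter> {..<\<alpha> + 1}. T0 \<alpha> t \<inter> {..<\<alpha>} \<subseteq> {..<r} \<and>
                 (\<forall>s\<in>{\<alpha><..<t}. T0 \<alpha> s \<inter> {..<\<alpha>} \<subseteq> {..<r} \<longrightarrow> r \<in> A0 s)})"
  by pat_completeness auto
termination
  by (relation "{(x, y). x < y}") (rule wf, auto)

declare A0.simps [simp del]

end

theory Submission
  imports Defs
begin

text \<open>
  Let \<open>\<gamma> \<le>\<^sub>1 \<delta>\<close> mean \<open>\<gamma> = \<delta>\<close> or \<open>\<gamma> <\<^sub>1 \<delta>\<close>.  The key equivalence, for additive principal \<open>\<beta>\<close>, \<open>n \<ge> 1\<close> and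
  \<open>s < \<beta>\<close>, is that \<open>\<beta> <\<^sub>1 \<beta>n + s + 1\<close> holds iff \<open>\<beta>\<close> is a limit of additive principal \<open>\<gamma> > s\<close> with
  \<open>\<gamma> \<le>\<^sub>1 \<gamma>n + s\<close>.  From left to right, one reflects \<open>\<beta>, \<beta>2, \<dots>, \<beta>n, \<beta>n + s\<close> below \<open>\<beta>\<close>.  From right to left,
  one maps \<open>\<beta>m + u\<close> to \<open>\<gamma>m + u\<close>, which respects \<open><\<^sub>1\<close> because \<open>x <\<^sub>1 y\<close> implies that \<open>x\<close> is a limit of
  additive principal ordinals, so the only \<open>x \<in> [\<gamma>, \<gamma>\<omega>)\<close> that can be on the left of \<open><\<^sub>1\<close> is \<open>\<gamma>\<close>.
  By this equivalence and the continuity of \<open><\<^sub>1\<close> on the right, \<open>A0 (\<alpha>n + s)\<close> consists of the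
  \<open>\<beta> \<le> \<alpha>\<close> with \<open>s < \<beta> <\<^sub>1 \<beta>n + s + 1\<close>.  This gives the first claim, since \<open>\<gamma> <\<^sub>1 \<gamma>\<omega>\<close> amounts to
  \<open>\<gamma> <\<^sub>1 \<gamma>n + 1\<close> for all \<open>n\<close>.  Unboundedness in \<open>\<kappa>\<close> of the \<open>\<beta>\<close> with \<open>\<beta> <\<^sub>1 \<beta>n + s + 1\<close> follows by
  induction on \<open>\<kappa>n + s\<close> from closing off under \<open>\<omega>\<close> many witness functions.
\<close>

section \<open>Ordinal arithmetic\<close>

lemma ordinal_pos_iff: "0 < (a::'a ordinal) \<longleftrightarrow> a \<noteq> 0"
  by (metis less_le ordinal_zero_le)

lemma ordinal_add_less_cancel [simp]: "(a::'a ordinal) + b < a + c \<longleftrightarrow> b < c"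
  using ordinal_add_props(2)[of b c a] ordinal_add_props(2)[of c b a]
  by (metis less_asym less_irrefl neqE)

lemma ordinal_add_le_cancel [simp]: "(a::'a ordinal) + b \<le> a + c \<longleftrightarrow> b \<le> c"
  by (metis not_le ordinal_add_less_cancel)

lemma ordinal_add_left_cancel [simp]: "(a::'a ordinal) + b = a + c \<longleftrightarrow> b = c"
  by (metis neqE less_irrefl ordinal_add_less_cancel)

lemma ordinal_zero_add: "0 + (a::'a ordinal) = a"
proof (induction a rule: less_induct)
  case (less a)
  have "0 + a \<le> a"
    by (rule ordinal_add_props(3)) (use less in auto)
  \<comment> \<open>If \<open>0 + a < a\<close>, strict monotonicity gives
    \<open>0 + (0 + a) < 0 + a\<close>, while the induction hypothesis at \<open>0 + a\<close> makes
    both sides equal.\<close>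
  moreover have "\<not> 0 + a < a"
    using less[of "0 + a"] ordinal_add_props(2)[of "0 + a" a 0] by auto
  ultimately show ?case by auto
qed

lemma ordinal_le_add_right: "(b::'a ordinal) \<le> a + b"
  using ordinal_add_mono_left[of 0 a b] by (simp add: ordinal_zero_add)

lemma ordinal_le_imp_add:
  assumes "(a::'a ordinal) \<le> b"
  obtains c where "b = a + c"
proof
  let ?c = "LEAST c. b \<le> a + c"
  have "b \<le> a + ?c"
    using ordinal_le_add_right by (rule LeastI)
  moreover have "a + ?c \<le> b"
    using assms by (rule ordinal_add_props(3)) (use not_less_Least not_le in blast)
  ultimately show "b = a + ?c" by simp
qed

lemma ordinal_add_assoc: "(a + b) + c = a + (b + (c::'a ordinal))"
proof (induction c rule: less_induct)
  case (less c)
  show ?case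
  proof (rule antisym)
    show "a + b + c \<le> a + (b + c)"
      by (rule ordinal_add_props(3)) (auto simp: less ordinal_add_props(1))
    show "a + (b + c) \<le> a + b + c"
    proof (rule ordinal_add_props(3))
      show "a \<le> a + b + c"
        using ordinal_add_props(1) order_trans by blast
      fix d assume "d < b + c"
      show "a + d < a + b + c"
      proof (cases "d < b")
        case True
        then show ?thesis
          using ordinal_add_props(1)[of "a + b" c] by (meson less_le_trans ordinal_add_props(2))
      next
        case False
        then obtain d' where "d = b + d'"
          by (meson not_le ordinal_le_imp_add)
        with \<open>d < b + c\<close> show ?thesis
          by (simp flip: less)
      qed
    qed
  qed
qed

instance ordinal :: (type) monoid_add
  by standard (auto simp: ordinal_add_assoc ordinal_zero_add)

section \<open>Finite multiples and division with remainder below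
  \<open>a * \<omega>\<close>\<close>

primrec nmul :: "'a ordinal \<Rightarrow> nat \<Rightarrow> 'a ordinal" where
  "nmul a 0 = 0"
| "nmul a (Suc n) = nmul a n + a"

lemma nmul_add: "nmul a (m + n) = nmul a m + nmul a n"
  by (induction n) (simp_all add: add.assoc)

lemma nmul_mono: "m \<le> n \<Longrightarrow> nmul a m \<le> nmul a n"
  by (metis le_Suc_ex nmul_add ordinal_add_props(1))

lemma nmul_mono_left: "a \<le> b \<Longrightarrow> nmul a n \<le> nmul b n"
  by (induction n) (auto intro: order_trans ordinal_add_mono_left)

lemma nmul_one_eq: "nmul a 1 = a"
  by simp

lemma le_nmul: "1 \<le> n \<Longrightarrow> a \<le> nmul a n"
  by (metis nmul_one_eq nmul_mono)

lemma limit_ordinal_add_one: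
  assumes "limit_ordinal a" "x < a"
  shows "x + 1 < a"
  using assms by (metis limit_ordinal_def less_le ordinal_add_one_le)

lemma less_omega_iff: "x < \<omega> \<longleftrightarrow> (\<exists>n. x = nmul 1 n)"
proof
  show "x < \<omega> \<Longrightarrow> \<exists>n. x = nmul 1 n"
  proof (induction x rule: less_induct)
    case (less x)
    then have "\<not> limit_ordinal x"
      unfolding omega_def by (metis not_less_Least)
    then consider "x = 0" | y where "x = y + 1"
      by (auto simp: limit_ordinal_def)
    then show ?case
    proof cases
      case 1
      then show ?thesis by (intro exI[of _ 0]) simp
    next
      case 2
      then have "y < x" by simp
      with less obtain n where "y = nmul 1 n"
        by (meson less_trans)
      then show ?thesis
        using 2 by (intro exI[of _ "Suc n"]) simp
    qed
  qed
  have "nmul 1 n < (\<omega> :: 'a ordinal)" for n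
    by (induction n) (use limit_ordinal_omega in
      \<open>auto simp: ordinal_pos_iff limit_ordinal_def intro: limit_ordinal_add_one\<close>)
  then show "\<exists>n. x = nmul 1 n \<Longrightarrow> x < \<omega>" by auto
qed

text \<open>The finite ordinals are the \<open>nmul 1 n\<close>, so this turns products with finite
  ordinals into recursion on \<open>nat\<close>, where ordinary induction applies.\<close>

lemma mult_nmul_one: "a * nmul 1 n = nmul a n"
  by (induction n) (simp_all add: ordinal_mult_zero ordinal_mult_succ)

lemma less_mult_omega_iff: "x < a * \<omega> \<longleftrightarrow> (\<exists>n. x < nmul a n)"
proof -
  have "{..<\<omega>} \<noteq> ({} :: 'a ordinal set)"
    using limit_ordinal_omega ordinal_pos_iff by (auto simp: limit_ordinal_def)
  then have "x < a * \<omega> \<longleftrightarrow> (\<exists>c<\<omega>. x < a * c)"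
    unfolding ordinal_mult_limit[OF limit_ordinal_omega]
    by (subst less_cSup_iff) (auto simp: bdd_above_image_less)
  then show ?thesis
    by (auto simp: less_omega_iff mult_nmul_one)
qed

lemma nmul_decomp:
  assumes "x < a * \<omega>"
  obtains n u where "u < a" "x = nmul a n + u"
proof -
  \<comment> \<open>The quotient is the predecessor of the first index whose multiple exceeds
    \<open>x\<close>; that index is nonzero because \<open>nmul a 0 = 0\<close>.\<close>
  let ?k = "LEAST n. x < nmul a n"
  have k: "x < nmul a ?k"
    using assms unfolding less_mult_omega_iff by (rule LeastI_ex)
  then obtain n where n: "?k = Suc n"
    by (metis nmul.simps(1) not0_implies_Suc ordinal_not_less_zero)
  then have "nmul a n \<le> x"
    by (metis lessI not_le not_less_Least)
  then obtain u where u: "x = nmul a n + u"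
    by (rule ordinal_le_imp_add)
  moreover have "u < a"
    using k u n by simp
  ultimately show thesis using that by blast
qed

lemma nmul_decomp_less_iff:
  assumes "u < a" "v < a"
  shows "nmul a m + u < nmul a n + v \<longleftrightarrow> m < n \<or> m = n \<and> u < v"
proof -
  have less: "nmul a m + u < nmul a n + v" if "m < n" "u < a" for m n u v
  proof -
    have "nmul a m + u < nmul a (Suc m)"
      using that by simp
    also have "\<dots> \<le> nmul a n + v"
      using that nmul_mono[of "Suc m" n a] ordinal_add_props(1) by (metis Suc_leI order_trans)
    finally show ?thesis .
  qed
  show ?thesis
    using less[of m n u v] less[of n m v u] assms by (metis less_asym ordinal_add_less_cancel neqE)
qed

lemma nmul_decomp_eq_iff:
  assumes "u < a" "v < a"
  shows "nmul a m + u = nmul a n + v \<longleftrightarrow> m = n \<and> u = v"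
  using nmul_decomp_less_iff[of u a v m n] nmul_decomp_less_iff[of v a u n m] assms
  by (metis less_irrefl neqE)

lemma nmul_decomp_le_iff:
  assumes "u < a" "v < a"
  shows "nmul a m + u \<le> nmul a n + v \<longleftrightarrow> m < n \<or> m = n \<and> u \<le> v"
  using nmul_decomp_less_iff[OF assms] nmul_decomp_eq_iff[OF assms] by (auto simp: le_less)

lemma nmul_add_less_mult_omega: "u < a \<Longrightarrow> nmul a n + u < a * \<omega>"
  unfolding less_mult_omega_iff by (intro exI[of _ "Suc n"]) simp

section \<open>Additive principal ordinals and limit points\<close>

lemma mult_omega_add_closed:
  assumes "x < a * \<omega>" "y < a * \<omega>"
  shows "x + y < a * \<omega>"
proof -
  obtain m n where mn: "x < nmul a m" "y < nmul a n"
    using assms by (auto simp: less_mult_omega_iff)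
  have "x + y \<le> nmul a m + y"
    using mn(1) by (intro ordinal_add_mono_left) simp
  also have "\<dots> < nmul a (m + n)"
    using mn(2) by (simp add: nmul_add)
  finally show ?thesis
    by (auto simp: less_mult_omega_iff)
qed

lemma less_mult_omega: "0 < a \<Longrightarrow> a < a * \<omega>"
  using nmul_add_less_mult_omega[of 0 a 1] by simp

text \<open>A power of \<omega> is a supremum of ordinals that are 1 or of the form
  \<open>y * \<omega>\<close>, all closed under addition. Two summands below the supremum lie below
  a common member.\<close>

lemma omega_pow_add_closed:
  assumes "x < omega_pow c" "y < omega_pow c"
  shows "x + y < omega_pow c"
proof -
  define A where "A = insert 1 ((\<lambda>d. omega_pow d * \<omega>) ` {..<c})"
  have bdd: "bdd_above A" and ne: "A \<noteq> {}"
    unfolding A_def by (rule bdd_above_omega_pow) simp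
  have pow: "omega_pow c = Sup A"
    unfolding A_def by (rule omega_pow.simps)
  have closed: "x + y < z" if "z \<in> A" "x < z" "y < z" for x y z
    using that by (auto simp: A_def mult_omega_add_closed)
  obtain z z' where z: "z \<in> A" "x < z" "z' \<in> A" "y < z'"
    using assms unfolding pow less_cSup_iff[OF ne bdd] by blast
  then have "max z z' \<in> A" "x < max z z'" "y < max z z'"
    by (auto simp: max_def)
  then have "\<exists>z\<in>A. x + y < z"
    using closed by blast
  then show ?thesis
    unfolding pow less_cSup_iff[OF ne bdd] .
qed

lemma omega_pow_strict_mono:
  assumes "c < d"
  shows "omega_pow c < omega_pow (d :: 'a ordinal)"
proof -
  have "0 < omega_pow c"
    using one_le_omega_pow[of c] by (metis not_le ordinal_less_one_iff ordinal_pos_iff)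
  then have "omega_pow c < omega_pow (c + 1)"
    unfolding omega_pow_succ by (rule less_mult_omega)
  also have "\<dots> \<le> omega_pow d"
    using assms by (intro omega_pow_mono) simp
  finally show ?thesis .
qed

lemma le_omega_pow: "c \<le> omega_pow c"
proof (induction c rule: less_induct)
  case (less c)
  then show ?case
    using omega_pow_strict_mono[of "omega_pow c" c] by (meson leD not_le)
qed

text \<open>Replaces powers of \<omega> by additive indecomposability. For the converse take the
  least \<open>c\<close> with \<open>x \<le> omega_pow c\<close>: all earlier powers are below
  \<open>x\<close>, hence so are their finite multiples, which gives
  \<open>omega_pow c \<le> x\<close>.\<close>

lemma Class0_iff: "x \<in> Class0 \<longleftrightarrow> 1 < x \<and> (\<forall>a<x. \<forall>b<x. a + b < x)"
proof
  assume "x \<in> Class0"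
  then obtain c where "0 < c" "x = omega_pow c"
    by (auto simp: Class0_def)
  then show "1 < x \<and> (\<forall>a<x. \<forall>b<x. a + b < x)"
    using omega_pow_strict_mono[of 0 c] by (auto simp: omega_pow_zero omega_pow_add_closed)
next
  assume x: "1 < x \<and> (\<forall>a<x. \<forall>b<x. a + b < x)"
  define c where "c = (LEAST c. x \<le> omega_pow c)"
  have c: "x \<le> omega_pow c"
    unfolding c_def using le_omega_pow by (rule LeastI)
  have nmul: "nmul a n < x" if "a < x" for a n
    by (induction n) (use that x in \<open>auto simp: ordinal_pos_iff\<close>)
  have "omega_pow d * \<omega> \<le> x" if "d < c" for d
  proof (rule leI)
    have "omega_pow d < x"
      using that unfolding c_def by (meson not_le not_less_Least)
    then show "\<not> x < omega_pow d * \<omega>"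
      unfolding less_mult_omega_iff using nmul by (meson less_asym)
  qed
  then have "omega_pow c \<le> x"
    unfolding omega_pow.simps[of c] using x by (intro cSup_least) auto
  then have "x = omega_pow c"
    using c by simp
  moreover have "c \<noteq> 0"
    using x calculation by (auto simp: omega_pow_zero)
  ultimately show "x \<in> Class0"
    by (auto simp: Class0_def ordinal_pos_iff)
qed

lemma mult_omega_Class0:
  assumes "0 < a"
  shows "a * \<omega> \<in> Class0"
proof -
  have "1 \<le> a"
    using assms by (metis not_le ordinal_less_one_iff less_irrefl)
  then have "1 < a * \<omega>"
    using less_mult_omega[OF assms] by (rule le_less_trans)
  then show ?thesis
    by (simp add: Class0_iff mult_omega_add_closed)
qed

lemma Class0_add: "p \<in> Class0 \<Longrightarrow> a < p \<Longrightarrow> b < p \<Longrightarrow> a + b < p"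
  by (simp add: Class0_iff)

lemma Class0_add_one: "p \<in> Class0 \<Longrightarrow> a + 1 < p \<longleftrightarrow> a < p"
  using Class0_iff[of p] ordinal_add_props(1)[of a 1] by (meson le_less_trans)

lemma Class0_pos: "p \<in> Class0 \<Longrightarrow> 0 < p"
  by (auto simp: Class0_iff ordinal_pos_iff)

lemma Class0_absorb:
  assumes "p \<in> Class0" "a < p"
  shows "a + p = p"
proof (rule antisym)
  show "a + p \<le> p"
    by (rule ordinal_add_props(3)) (use assms Class0_add in auto)
qed (rule ordinal_le_add_right)

lemma Class0_nmul: "p \<in> Class0 \<Longrightarrow> a < p \<Longrightarrow> nmul a n < p"
  by (induction n) (auto simp: Class0_pos Class0_add)

lemma Class0_mult_omega_le: "p \<in> Class0 \<Longrightarrow> a < p \<Longrightarrow> a * \<omega> \<le> p"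
  by (meson Class0_nmul less_asym less_mult_omega_iff not_le)

lemma Class0_nmul_add:
  assumes "p \<in> Class0" "nmul p m + u \<in> Class0" "u < p" "1 \<le> m"
  shows "m = 1 \<and> u = 0"
proof (rule ccontr)
  assume "\<not> (m = 1 \<and> u = 0)"
  then have "nmul p 1 + 0 < nmul p m + u"
    using assms Class0_pos by (subst nmul_decomp_less_iff) (auto simp: ordinal_pos_iff)
  then have "nmul p (Suc m) < nmul p m + u"
    using Class0_nmul[OF assms(2), of p "Suc m"] by simp
  then show False
    using assms(3) by simp
qed

text \<open>The right-hand side does not mention \<open>p\<close>: addition below \<open>p\<omega>\<close> looks the same for all \<open>p\<close>.\<close>

lemma nmul_decomp_add_eq_iff:
  assumes "p \<in> Class0" "u < p" "v < p" "w < p"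
  shows "(nmul p m + u) + (nmul p k + v) = nmul p j + w \<longleftrightarrow>
    (if k = 0 then j = m \<and> w = u + v else j = m + k \<and> w = v)"
proof (cases k)
  case 0
  then show ?thesis
    using assms nmul_decomp_eq_iff[of "u + v" p w m j] by (auto simp: Class0_add add.assoc)
next
  case (Suc k')
  have "u + nmul p k = nmul p k"
    unfolding Suc using Class0_absorb[OF assms(1,2)] nmul_add[of p 1 k'] by (metis add.assoc nmul_one_eq plus_1_eq_Suc)
  then have "(nmul p m + u) + (nmul p k + v) = nmul p (m + k) + v"
    by (simp add: nmul_add add.assoc[symmetric]) (simp add: add.assoc)
  then show ?thesis
    using assms Suc nmul_decomp_eq_iff[of v p w "m + k" j] by auto
qed

section \<open>Limit points of sets of ordinals\<close>

lemma Lim_pts_iff: "b \<in> Lim_pts A \<longleftrightarrow> b \<noteq> 0 \<and> (\<forall>x<b. \<exists>a\<in>A. x < a \<and> a < b)"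
proof -
  have bdd: "bdd_above (A \<inter> {..<b})"
    by (auto simp: bdd_above_def intro: less_imp_le)
  show ?thesis
  proof (cases "A \<inter> {..<b} = {}")
    case True
    then have "b \<notin> Lim_pts A" and "\<not> (\<exists>a\<in>A. 0 < a \<and> a < b)"
      by (auto simp: Lim_pts_def)
    then show ?thesis
      by (metis ordinal_pos_iff)
  next
    case False
    then have "Sup (A \<inter> {..<b}) \<le> b"
      by (intro cSup_least) auto
    then have "b = Sup (A \<inter> {..<b}) \<longleftrightarrow> (\<forall>x<b. x < Sup (A \<inter> {..<b}))"
      by (metis leD leI order.antisym order.order_iff_strict)
    then show ?thesis
      unfolding Lim_pts_def mem_Collect_eq less_cSup_iff[OF False bdd] by blast
  qed
qed

text \<open>A limit point above \<open>a\<close> would need elements of the set above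
  \<open>a\<close>. Since the cut-off commutes with \<open>Lim_pts\<close>, the bound in
  \<open>A0\<close> can be carried along unchanged.\<close>

lemma Lim_pts_Int_atMost: "Lim_pts (A \<inter> {..a}) = Lim_pts A \<inter> {..a}"
proof (intro equalityI subsetI)
  fix b assume b: "b \<in> Lim_pts (A \<inter> {..a})"
  have "b \<le> a"
  proof (rule leI notI)+
    assume "a < b"
    with b obtain c where "c \<in> A \<inter> {..a}" "a < c"
      unfolding Lim_pts_iff by blast
    then show False using leD by auto
  qed
  with b show "b \<in> Lim_pts A \<inter> {..a}"
    by (simp add: Lim_pts_iff) blast
next
  fix b assume "b \<in> Lim_pts A \<inter> {..a}"
  then have b: "b \<noteq> 0" "\<forall>x<b. \<exists>c\<in>A. x < c \<and> c < b" "b \<le> a"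
    by (simp_all add: Lim_pts_iff)
  have "c \<in> A \<inter> {..a}" if "c \<in> A" "c < b" for c
    using that b(3) by simp
  with b show "b \<in> Lim_pts (A \<inter> {..a})"
    unfolding Lim_pts_iff by blast
qed

lemma Lim_pts_Class0: "Lim_pts Class0 \<subseteq> Class0"
proof
  fix b :: "'a ordinal" assume b: "b \<in> Lim_pts Class0"
  then obtain p where "p \<in> Class0" "p < b"
    unfolding Lim_pts_iff by (meson ordinal_pos_iff)
  moreover have "x + y < b" if "x < b" "y < b" for x y
  proof -
    have "max x y < b" using that by simp
    with b obtain q where "q \<in> Class0" "max x y < q" "q < b"
      unfolding Lim_pts_iff by blast
    then show ?thesis
      using Class0_add[of q x y] by (simp add: less_trans[of _ q])
  qed
  ultimately show "b \<in> Class0"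
    by (auto simp: Class0_iff)
qed

section \<open>The relation \<open><\<^sub>1\<close>\<close>

definition embeds :: "'a ordinal set \<Rightarrow> ('a ordinal \<Rightarrow> 'a ordinal) \<Rightarrow> bool" where
  "embeds Z h \<longleftrightarrow> (\<forall>a\<in>Z. \<forall>b\<in>Z. (a < b \<longleftrightarrow> h a < h b) \<and> (a <\<^sub>1 b \<longleftrightarrow> h a <\<^sub>1 h b) \<and>
     (\<forall>c\<in>Z. a + b = c \<longleftrightarrow> h a + h b = h c))"

lemma
  assumes "embeds Z h" "a \<in> Z" "b \<in> Z"
  shows embeds_less: "h a < h b \<longleftrightarrow> a < b"
    and embeds_less1: "h a <\<^sub>1 h b \<longleftrightarrow> a <\<^sub>1 b"
    and embeds_add: "c \<in> Z \<Longrightarrow> a + b = c \<Longrightarrow> h c = h a + h b"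
  using assms unfolding embeds_def by metis+

lemma embeds_inj_on: "embeds Z h \<Longrightarrow> inj_on h Z"
  by (auto simp: embeds_def inj_on_def) (metis less_irrefl neqE)

lemma less1_iff:
  "a <\<^sub>1 b \<longleftrightarrow> a < b \<and> (\<forall>Z. finite Z \<and> Z \<subseteq> {..<b} \<longrightarrow>
     (\<exists>h. h ` Z \<subseteq> {..<a} \<and> (\<forall>x\<in>Z \<inter> {..<a}. h x = x) \<and> embeds Z h))"
proof -
  have eq: "(\<exists>Z' h. finite Z' \<and> Z' \<subseteq> {..<a} \<and> bij_betw h Z Z' \<and> (\<forall>x\<in>Z \<inter> {..<a}. h x = x) \<and>
         (\<forall>a\<^sub>1\<in>Z. \<forall>a\<^sub>2\<in>Z.
           (a\<^sub>1 < a\<^sub>2 \<longleftrightarrow> h a\<^sub>1 < h a\<^sub>2) \<and>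
           (a\<^sub>1 <\<^sub>1 a\<^sub>2 \<longleftrightarrow> h a\<^sub>1 <\<^sub>1 h a\<^sub>2) \<and>
           (a\<^sub>1 + a\<^sub>2 \<in> Z \<longleftrightarrow> h a\<^sub>1 + h a\<^sub>2 \<in> Z') \<and>
           (a\<^sub>1 + a\<^sub>2 \<in> Z \<longrightarrow> h (a\<^sub>1 + a\<^sub>2) = h a\<^sub>1 + h a\<^sub>2))) \<longleftrightarrow>
     (\<exists>h. h ` Z \<subseteq> {..<a} \<and> (\<forall>x\<in>Z \<inter> {..<a}. h x = x) \<and> embeds Z h)" (is "(\<exists>Z' h. ?P Z' h) \<longleftrightarrow> (\<exists>h. ?Q h)")
    if fin: "finite Z" for Z
  proof
    assume "\<exists>Z' h. ?P Z' h"
    then obtain Z' h where P: "?P Z' h" by blast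
    then have Z': "Z' = h ` Z" and inj: "inj_on h Z"
      by (auto simp: bij_betw_def)
    have "a\<^sub>1 + a\<^sub>2 = c \<longleftrightarrow> h a\<^sub>1 + h a\<^sub>2 = h c" if "a\<^sub>1 \<in> Z" "a\<^sub>2 \<in> Z" "c \<in> Z" for a\<^sub>1 a\<^sub>2 c
      using P that inj unfolding Z' by (metis imageI inj_onD)
    then have "?Q h"
      using P unfolding embeds_def Z' by simp
    then show "\<exists>h. ?Q h" by blast
  next
    assume "\<exists>h. ?Q h"
    then obtain h where Q: "?Q h" by blast
    have inj: "inj_on h Z"
      using Q embeds_inj_on by blast
    have sum: "\<forall>c\<in>Z. a\<^sub>1 + a\<^sub>2 = c \<longleftrightarrow> h a\<^sub>1 + h a\<^sub>2 = h c" if "a\<^sub>1 \<in> Z" "a\<^sub>2 \<in> Z" for a\<^sub>1 a\<^sub>2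
      using Q that unfolding embeds_def by blast
    have mem: "a\<^sub>1 + a\<^sub>2 \<in> Z \<longleftrightarrow> h a\<^sub>1 + h a\<^sub>2 \<in> h ` Z"
      and map: "a\<^sub>1 + a\<^sub>2 \<in> Z \<longrightarrow> h (a\<^sub>1 + a\<^sub>2) = h a\<^sub>1 + h a\<^sub>2" if "a\<^sub>1 \<in> Z" "a\<^sub>2 \<in> Z" for a\<^sub>1 a\<^sub>2
      using sum[OF that] by (auto simp: image_iff)
    have "?P (h ` Z) h"
      using Q fin inj mem map unfolding embeds_def by (simp add: bij_betw_def)
    then show "\<exists>Z' h. ?P Z' h" by blast
  qed
  show ?thesis
    unfolding less1.simps[of a b] by (intro conj_cong refl all_cong1 imp_cong eq) (erule conjunct1)
qed

lemma less1_less: "a <\<^sub>1 b \<Longrightarrow> a < b"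
  by (simp add: less1_iff)

lemma less1_embeds:
  assumes "a <\<^sub>1 b" "finite Z" "Z \<subseteq> {..<b}"
  obtains h where "h ` Z \<subseteq> {..<a}" "\<And>x. x \<in> Z \<Longrightarrow> x < a \<Longrightarrow> h x = x" "embeds Z h"
proof -
  obtain h where "h ` Z \<subseteq> {..<a}" "\<forall>x\<in>Z \<inter> {..<a}. h x = x" "embeds Z h"
    using assms unfolding less1_iff[of a b] by blast
  then show thesis
    by (intro that[of h]) simp_all
qed

lemma less1_mono:
  assumes "a <\<^sub>1 c" "a < b" "b \<le> c"
  shows "a <\<^sub>1 b"
proof -
  have "Z \<subseteq> {..<c}" if "Z \<subseteq> {..<b}" for Z
    using that assms(3) by (meson lessThan_subset_iff subset_trans)
  with assms(1,2) show ?thesis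
    unfolding less1_iff[of a] by simp
qed

text \<open>Compose an embedding below \<open>b\<close> with one below \<open>a\<close>; elements of
  \<open>Z\<close> below \<open>a\<close> are fixed by both.\<close>

lemma less1_trans:
  assumes "a <\<^sub>1 b" "b <\<^sub>1 c"
  shows "a <\<^sub>1 c"
  unfolding less1_iff[of a c]
proof (intro conjI allI impI)
  show "a < c"
    using assms less1_less less_trans by blast
  fix Z assume Z: "finite Z \<and> Z \<subseteq> {..<c}"
  obtain h where h: "h ` Z \<subseteq> {..<b}" "\<And>x. x \<in> Z \<Longrightarrow> x < b \<Longrightarrow> h x = x" "embeds Z h"
    using less1_embeds[OF assms(2)] Z by blast
  obtain k where k: "k ` h ` Z \<subseteq> {..<a}" "\<And>x. x \<in> h ` Z \<Longrightarrow> x < a \<Longrightarrow> k x = x" "embeds (h ` Z) k"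
    using less1_embeds[OF assms(1) _ h(1)] Z by blast
  show "\<exists>h. h ` Z \<subseteq> {..<a} \<and> (\<forall>x\<in>Z \<inter> {..<a}. h x = x) \<and> embeds Z h"
  proof (intro exI[of _ "k \<circ> h"] conjI ballI)
    show "(k \<circ> h) ` Z \<subseteq> {..<a}"
      using k(1) by (simp add: image_comp)
    show "(k \<circ> h) x = x" if "x \<in> Z \<inter> {..<a}" for x
      using that h(2)[of x] k(2)[of x] less1_less[OF assms(1)] by (force simp: image_iff)
    show "embeds Z (k \<circ> h)"
      using h(3) k(3) by (simp add: embeds_def)
  qed
qed

text \<open>Continuity on the right: a finite subset of \<open>b\<close> is already contained in
  some \<open>d + 1\<close> with \<open>d < b\<close>.\<close>

lemma less1_limitI:
  assumes "a < b" and step: "\<And>d. a \<le> d \<Longrightarrow> d < b \<Longrightarrow> a <\<^sub>1 d + 1"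
  shows "a <\<^sub>1 b"
  unfolding less1_iff[of a b]
proof (intro conjI allI impI)
  fix Z assume Z: "finite Z \<and> Z \<subseteq> {..<b}"
  define d where "d = Max (insert a Z)"
  have "a \<le> d" "d < b" "Z \<subseteq> {..<d + 1}"
    using Z assms(1) by (auto simp: d_def)
  with step Z show "\<exists>h. h ` Z \<subseteq> {..<a} \<and> (\<forall>x\<in>Z \<inter> {..<a}. h x = x) \<and> embeds Z h"
    unfolding less1_iff[of a] by blast
qed fact

text \<open>
  With \<open>Z = {x, y, a}\<close> where \<open>x + y = a\<close> one gets that \<open>a\<close> is additively indecomposable.  With
  \<open>Z = {d, a}\<close> the equation \<open>d + a = a\<close> forces \<open>d\<omega> \<le> h(a) < a\<close>.
\<close>

lemma less1_imp_Lim_pts: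
  assumes "a <\<^sub>1 b"
  shows "a \<in> Lim_pts Class0"
proof -
  have a1: "a <\<^sub>1 a + 1"
    by (rule less1_mono[OF assms]) (simp_all add: less1_less[OF assms])
  have add: "x + y < a" if xy: "x < a" "y < a" for x y
  proof (rule ccontr)
    assume "\<not> x + y < a"
    moreover obtain z where z: "a = x + z"
      by (rule ordinal_le_imp_add[of x a]) (use xy(1) in auto)
    ultimately have "z < a"
      using xy(2) by (metis le_less_trans not_le ordinal_add_le_cancel)
    obtain h where h: "h ` {x, z, a} \<subseteq> {..<a}" "h x = x" "h z = z" "embeds {x, z, a} h"
      by (rule less1_embeds[OF a1, of "{x, z, a}"]) (use \<open>x < a\<close> \<open>z < a\<close> in auto)
    have "h a = h x + h z"
      by (rule embeds_add[OF h(4)]) (use z in simp_all)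
    also have "\<dots> = a"
      by (simp only: h(2,3) z[symmetric])
    finally have "h a = a" .
    then show False
      using h(1) by simp
  qed
  have "1 < a"
  proof (rule ccontr)
    assume "\<not> 1 < a"
    then have a: "a = 0 \<or> a = 1"
      by (metis le_less not_le ordinal_less_one_iff)
    obtain h where h: "h ` {0, a} \<subseteq> {..<a}" "embeds {0, a} h"
      by (rule less1_embeds[OF a1, of "{0, a}"]) auto
    then have "h 0 = 0" "h a = 0" "a = 1"
      using a by auto
    then show False
      using embeds_less[OF h(2), of 0 a] by simp
  qed
  then have a: "a \<in> Class0"
    using add by (simp add: Class0_iff)
  have "\<exists>p\<in>Class0. x < p \<and> p < a" if "x < a" for x
  proof -
    \<comment> \<open>The successor makes \<open>d\<close> positive, so that
      \<open>d * \<omega>\<close> is additive principal and lies strictly above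
      \<open>x\<close>.\<close>
    define d where "d = x + 1"
    have d: "0 < d" "d < a" "x < d"
      using that a by (auto simp: d_def Class0_add_one ordinal_pos_iff)
    obtain h where h: "h ` {d, a} \<subseteq> {..<a}" "h d = d" "embeds {d, a} h"
      by (rule less1_embeds[OF a1, of "{d, a}"]) (use d in auto)
    have "h a = h d + h a"
      by (rule embeds_add[OF h(3)]) (simp_all add: Class0_absorb[OF a d(2)])
    then have d_h: "d + h a = h a"
      by (simp only: h(2))
    then have "nmul d n + h a = h a" for n
      by (induction n) (simp_all add: add.assoc d_h)
    then have "nmul d n \<le> h a" for n
      by (metis ordinal_add_props(1))
    then have "d * \<omega> \<le> h a"
      by (meson less_mult_omega_iff not_le)
    then have "d * \<omega> < a"
      using h(1) by auto
    then show ?thesis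
      using d less_mult_omega mult_omega_Class0 less_trans by blast
  qed
  then show ?thesis
    using Class0_pos[OF a] by (auto simp: Lim_pts_iff)
qed

section \<open>Reflection of \<open>[\<gamma>, \<gamma>\<omega>)\<close>\<close>

text \<open>
  \<open>A0 (\<alpha>n + s)\<close> is the part of \<open>reflecting n (s + 1)\<close> up to \<open>\<alpha>\<close> (theorem \<open>A0_eq\<close>), so \<open>\<alpha>\<close> only enters
  as a bound.
\<close>

definition reflecting :: "nat \<Rightarrow> 'a ordinal \<Rightarrow> 'a ordinal set" where
  "reflecting n s = {g \<in> Class0. s < g \<and> (g = nmul g n + s \<or> g <\<^sub>1 nmul g n + s)}"

lemma reflecting_Class0: "g \<in> reflecting n s \<Longrightarrow> g \<in> Class0"
  by (simp add: reflecting_def)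

lemma reflecting_less: "g \<in> reflecting n s \<Longrightarrow> s < g"
  by (simp add: reflecting_def)

lemma le_nmul_add: "1 \<le> n \<Longrightarrow> g \<le> nmul g n + s"
  by (meson le_nmul order_trans ordinal_add_props(1))

text \<open>The starting point of the hierarchy: here \<open>nmul g n + s\<close> is
  \<open>g\<close> itself, so the equality disjunct holds for every additive principal
  \<open>g\<close>.\<close>

lemma reflecting_one_zero: "reflecting 1 0 = Class0"
  by (auto simp: reflecting_def Class0_pos)

lemma reflecting_succ_iff:
  assumes "1 \<le> n"
  shows "g \<in> reflecting n (s + 1) \<longleftrightarrow> g \<in> Class0 \<and> s < g \<and> g <\<^sub>1 nmul g n + (s + 1)"
proof -
  have "g < nmul g n + (s + 1)"
    using le_nmul_add[OF assms, of g s] by (simp flip: add.assoc)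
  then show ?thesis
    by (auto simp: reflecting_def Class0_add_one)
qed

lemma reflecting_less1:
  assumes "g \<in> reflecting n s" "1 \<le> m" "g < nmul g m + u" "nmul g m + u \<le> nmul g n + s"
  shows "g <\<^sub>1 nmul g m + u"
proof -
  have "g \<noteq> nmul g n + s"
    using assms(3,4) by auto
  then show ?thesis
    using assms less1_mono by (auto simp: reflecting_def)
qed

lemma reflecting_mono:
  assumes "g \<in> reflecting n s" "1 \<le> m" "u < g" "nmul g m + u \<le> nmul g n + s"
  shows "g \<in> reflecting m u"
  using assms reflecting_less1[OF assms(1,2)] le_nmul_add[OF assms(2), of g u]
  by (auto simp: reflecting_def le_less)

text \<open>Each \<open>d\<close> between \<open>g\<close> and \<open>nmul g n + s\<close> is
  \<open>nmul g m + u\<close> with \<open>m \<ge> 1\<close> and \<open>u < g\<close>; continuity of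
  \<open><\<^sub>1\<close> on the right combines these smaller levels.\<close>

lemma reflecting_limitI:
  assumes g: "g \<in> Class0" "s < g" "1 \<le> n"
    and step: "\<And>m u. 1 \<le> m \<Longrightarrow> u < g \<Longrightarrow> nmul g m + u < nmul g n + s \<Longrightarrow> g \<in> reflecting m (u + 1)"
  shows "g \<in> reflecting n s"
proof -
  have "g <\<^sub>1 nmul g n + s" if less: "g < nmul g n + s"
  proof (rule less1_limitI[OF less])
    fix d assume d: "g \<le> d" "d < nmul g n + s"
    then have "d < g * \<omega>"
      using nmul_add_less_mult_omega[OF g(2), of n] by (meson less_trans)
    then obtain m u where mu: "u < g" "d = nmul g m + u"
      by (rule nmul_decomp)
    have "m \<noteq> 0"
      using mu d(1) by (auto intro: ccontr)
    then have "g \<in> reflecting m (u + 1)"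
      using mu d by (intro step) auto
    then show "g <\<^sub>1 d + 1"
      using \<open>m \<noteq> 0\<close> mu(2) reflecting_succ_iff[of m g u] by (simp add: add.assoc)
  qed
  then show ?thesis
    using g le_nmul_add[OF g(3), of g s] by (auto simp: reflecting_def le_less)
qed

text \<open>
  The tail \<open>nmul \<beta> 1, \<dots>, nmul \<beta> n, nmul \<beta> n + s\<close> of \<open>Z\<close> forces its image under an embedding \<open>h\<close>
  to have the same shape over \<open>h(\<beta>)\<close>.
\<close>

lemma reflecting_succ_subset_Lim_pts:
  assumes n: "1 \<le> n" and b: "b \<in> reflecting n (s + 1)"
  shows "b \<in> Lim_pts (reflecting n s)"
proof (cases "b = nmul b n + s")
  case True
  have "s < b" "b <\<^sub>1 nmul b n + (s + 1)" "b \<in> Class0"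
    using b n by (simp_all add: reflecting_succ_iff)
  have "n = 1 \<and> s = 0"
    using True \<open>b \<in> Class0\<close> \<open>s < b\<close> n by (intro Class0_nmul_add[of b]) auto
  then show ?thesis
    using less1_imp_Lim_pts[OF \<open>b <\<^sub>1 nmul b n + (s + 1)\<close>] by (metis reflecting_one_zero)
next
  case False
  then have less: "b < nmul b n + s"
    using le_nmul_add[OF n, of b s] by simp
  have sb: "s < b" and b1: "b <\<^sub>1 nmul b n + s + 1" and bC: "b \<in> Class0"
    using b n by (simp_all add: reflecting_succ_iff add.assoc)
  have b_top: "b <\<^sub>1 nmul b n + s"
    using less1_mono[OF b1 less] by (simp add: less_imp_le)
  have "\<exists>g\<in>reflecting n s. x < g \<and> g < b" if xb: "x < b" for x
  proof -
    \<comment> \<open>An embedding below \<open>b\<close> fixes \<open>y\<close>, so the image of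
      \<open>b\<close> lies above both the given bound \<open>x\<close> and the remainder
      \<open>s\<close>.\<close>
    define y where "y = max x s"
    have y: "y < b" "x \<le> y" "s \<le> y"
      using xb sb by (auto simp: y_def)
    let ?Z = "insert y (insert s (insert (nmul b n + s) (nmul b ` {1..n})))"
    have "z < nmul b n + s + 1" if "z \<in> ?Z" for z
    proof -
      have "nmul b k \<le> nmul b n + s" if "k \<in> {1..n}" for k
        using that nmul_mono[of k n b] ordinal_add_props(1) by (meson atLeastAtMost_iff order_trans)
      then show ?thesis
        using \<open>z \<in> ?Z\<close> less y sb by auto
    qed
    then have "?Z \<subseteq> {..<nmul b n + s + 1}"
      by blast
    then obtain h where h: "h ` ?Z \<subseteq> {..<b}" "\<And>z. z \<in> ?Z \<Longrightarrow> z < b \<Longrightarrow> h z = z" "embeds ?Z h"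
      using less1_embeds[OF b1, of ?Z] by blast
    have bZ: "b \<in> ?Z"
      using n nmul_one_eq[of b] by (auto simp: image_iff intro!: bexI[of _ 1])
    define g where "g = h b"
    have "h y = y" "h s = s"
      using h(2) y sb by auto
    then have yg: "y < g"
      using embeds_less[OF h(3), of y b] bZ y by (simp add: g_def)
    have kZ: "nmul b k \<in> ?Z" if "1 \<le> k" "k \<le> n" for k
      using that by simp
    have mult: "h (nmul b k) = nmul g k" if "1 \<le> k" "k \<le> n" for k
      using that
    proof (induction k rule: nat_induct_at_least)
      case base
      show ?case by (simp add: g_def)
    next
      case (Suc k)
      have "h (nmul b (Suc k)) = h (nmul b k) + h b"
        by (rule embeds_add[OF h(3) kZ bZ kZ]) (use Suc in simp_all)
      with Suc show ?case by (simp add: g_def)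
    qed
    have "h (nmul b n + s) = h (nmul b n) + h s"
      by (rule embeds_add[OF h(3)]) (use n in auto)
    then have top: "h (nmul b n + s) = nmul g n + s"
      using mult n \<open>h s = s\<close> by simp
    have g1: "g <\<^sub>1 nmul g n + s"
      using embeds_less1[OF h(3) bZ, of "nmul b n + s"] b_top top by (simp add: g_def)
    then have "g \<in> Class0"
      using less1_imp_Lim_pts Lim_pts_Class0 by blast
    then have "g \<in> reflecting n s"
      using g1 yg y by (auto simp: reflecting_def)
    moreover have "g < b"
      using h(1) bZ unfolding g_def by blast
    ultimately show ?thesis
      using yg y by (meson le_less_trans)
  qed
  then show ?thesis
    using Class0_pos[OF bC] by (auto simp: Lim_pts_iff)
qed

lemma Lim_pts_mono: "A \<subseteq> B \<Longrightarrow> Lim_pts A \<subseteq> Lim_pts B"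
  unfolding subset_iff Lim_pts_iff by blast

lemma Lim_pts_reflecting_Class0: "b \<in> Lim_pts (reflecting n s) \<Longrightarrow> b \<in> Class0"
  using Lim_pts_Class0 Lim_pts_mono[of "reflecting n s" Class0] reflecting_Class0 by blast

lemma Lim_pts_reflecting_less:
  assumes "b \<in> Lim_pts (reflecting n s)"
  shows "s < b"
proof -
  obtain g where "g \<in> reflecting n s" "g < b"
    using assms unfolding Lim_pts_iff by (meson ordinal_pos_iff)
  then show ?thesis
    using reflecting_less less_trans by blast
qed

text \<open>
  The embedding replaces \<open>\<beta>\<close> by a suitable \<open>\<gamma> < \<beta>\<close> in \<open>reflecting n s\<close>, i.e. it maps \<open>\<beta>m + u\<close> to
  \<open>\<gamma>m + u\<close>.  It respects \<open>x <\<^sub>1 y\<close> for \<open>x < \<beta> \<le> y\<close> once \<open>\<gamma>\<close> is so large that \<open>x <\<^sub>1 \<gamma>\<close> implies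
  \<open>x <\<^sub>1 \<beta>\<close>.
\<close>

lemma Lim_pts_reflecting_subset_reflecting_succ:
  assumes "1 \<le> n" "b \<in> Lim_pts (reflecting n s)"
  shows "b \<in> reflecting n (s + 1)"
  using assms
proof (induction "nmul b n + s" arbitrary: n s rule: less_induct)
  case less
  note n = less.prems(1) and b = less.prems(2)
  have bC: "b \<in> Class0" and sb: "s < b"
    using b Lim_pts_reflecting_Class0 Lim_pts_reflecting_less by blast+
  \<comment> \<open>Members of \<open>reflecting n s\<close> above \<open>u\<close> also belong to
    the smaller level \<open>(m, u)\<close>, because multiples with remainders compare alike over
    \<open>g\<close> and over \<open>b\<close>. So \<open>b\<close> is a limit point there too, and
    the induction hypothesis applies.\<close>
  have lower: "b \<in> reflecting m (u + 1)"
    if m: "1 \<le> m" and u: "u < b" and mu: "nmul b m + u < nmul b n + s" for m u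
  proof (rule less.hyps[OF mu m])
    have "g \<in> reflecting m u" if "g \<in> reflecting n s" "u < g" for g
    proof (rule reflecting_mono[OF that(1) m that(2)])
      show "nmul g m + u \<le> nmul g n + s"
        using nmul_decomp_less_iff[OF u sb, of m n] nmul_decomp_less_iff[OF that(2), of s m n]
          mu reflecting_less[OF that(1)] by (simp add: less_imp_le)
    qed
    then have "\<exists>g\<in>reflecting m u. x < g \<and> g < b" if "x < b" for x
      using b u that unfolding Lim_pts_iff by (metis max_less_iff_conj)
    then show "b \<in> Lim_pts (reflecting m u)"
      using b by (simp add: Lim_pts_iff)
  qed
  have bR: "b \<in> reflecting n s"
    using bC sb n lower by (rule reflecting_limitI)
  define t where "t = nmul b n + s"
  have "b <\<^sub>1 t + 1"
    unfolding less1_iff[of b]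
  proof (intro conjI allI impI)
    show "b < t + 1"
      using le_nmul_add[OF n] by (simp add: t_def)
    fix Z assume Z: "finite Z \<and> Z \<subseteq> {..<t + 1}"
    have "\<exists>m u. u < b \<and> z = nmul b m + u" if "z \<in> Z" for z
    proof -
      have "z < b * \<omega>"
        using that Z nmul_add_less_mult_omega[OF sb, of n] by (force simp: t_def)
      then show ?thesis
        using nmul_decomp by metis
    qed
    then obtain M U where MU: "\<And>z. z \<in> Z \<Longrightarrow> U z < b \<and> z = nmul b (M z) + U z"
      by metis
    \<comment> \<open>If \<open>z <\<^sub>1 b\<close> fails, then by continuity on the right it
      already fails at some \<open>d + 1 < b\<close>, and by monotonicity at every larger
      \<open>g\<close>. This gives the threshold \<open>D z\<close>.\<close>
    have "\<exists>d<b. \<forall>g. d \<le> g \<longrightarrow> z < g \<longrightarrow> z <\<^sub>1 g \<longrightarrow> z <\<^sub>1 b" if zb: "z < b" for z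
    proof (cases "z <\<^sub>1 b")
      case True
      then show ?thesis using zb by blast
    next
      case False
      then obtain d where d: "z \<le> d" "d < b" "\<not> z <\<^sub>1 d + 1"
        using less1_limitI[OF zb] by blast
      have "\<not> z <\<^sub>1 g" if "d + 1 \<le> g" for g
        using less1_mono[of z g "d + 1"] d that by auto
      then show ?thesis
        using d Class0_add_one[OF bC] by blast
    qed
    then obtain D where D: "\<And>z. z < b \<Longrightarrow> D z < b"
      "\<And>z g. z < b \<Longrightarrow> D z \<le> g \<Longrightarrow> z < g \<Longrightarrow> z <\<^sub>1 g \<Longrightarrow> z <\<^sub>1 b"
      by metis
    \<comment> \<open>A \<open>g\<close> above this bound exceeds \<open>s\<close> and all
      remainders, so decompositions over \<open>g\<close> are again normal forms, and it passes all
      the finitely many thresholds.\<close>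
    define x where "x = Max (insert s (U ` Z \<union> D ` (Z \<inter> {..<b})))"
    have "x < b"
      using Z sb MU D(1) by (auto simp: x_def)
    then obtain g where g: "g \<in> reflecting n s" "x < g" "g < b"
      using b unfolding Lim_pts_iff by blast
    have gC: "g \<in> Class0"
      using g reflecting_Class0 by blast
    have Ug: "U z < g" if "z \<in> Z" for z
    proof -
      have "U z \<le> x"
        unfolding x_def using that Z by (intro Max_ge) auto
      then show ?thesis using g(2) by (rule le_less_trans)
    qed
    have Dg: "D z \<le> g" if "z \<in> Z" "z < b" for z
    proof -
      have "D z \<le> x"
        unfolding x_def using that Z by (intro Max_ge) auto
      then show ?thesis using g(2) by simp
    qed
    have sg: "s < g"
      using g reflecting_less by blast
    define e where "e z = nmul g (M z) + U z" for z
    have M0: "M z = 0 \<longleftrightarrow> z < b" and e_id: "z < b \<Longrightarrow> e z = z" if "z \<in> Z" for z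
    proof -
      have "nmul b (M z) + U z < nmul b 1 + 0 \<longleftrightarrow> M z < 1 \<or> M z = 1 \<and> U z < 0"
        using MU[OF that] Class0_pos[OF bC] by (intro nmul_decomp_less_iff) auto
      then show iff: "M z = 0 \<longleftrightarrow> z < b"
        using MU[OF that] by simp
      show "e z = z" if "z < b"
        using iff that MU[OF \<open>z \<in> Z\<close>] by (simp add: e_def)
    qed
    have e_less: "e z < e w \<longleftrightarrow> z < w" if "z \<in> Z" "w \<in> Z" for z w
      using nmul_decomp_less_iff[of "U z" b "U w" "M z" "M w"]
        nmul_decomp_less_iff[of "U z" g "U w" "M z" "M w"] MU Ug that by (metis e_def)
    have e_add: "e z + e w = e v \<longleftrightarrow> z + w = v" if "z \<in> Z" "w \<in> Z" "v \<in> Z" for z w v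
      using nmul_decomp_add_eq_iff[OF bC, of "U z" "U w" "U v" "M z" "M w" "M v"]
        nmul_decomp_add_eq_iff[OF gC, of "U z" "U w" "U v" "M z" "M w" "M v"] MU Ug that
      by (metis e_def)
    have e_top: "e z \<le> nmul g n + s" if "z \<in> Z" for z
    proof -
      have "z \<le> t"
        using that Z by force
      then show ?thesis
        using nmul_decomp_le_iff[of "U z" b s "M z" n] nmul_decomp_le_iff[of "U z" g s "M z" n]
          MU[OF that] Ug[OF that] sb sg by (simp add: e_def t_def)
    qed
    have M1: "1 \<le> M z" if "z \<in> Z" "b \<le> z" for z
      using that M0 by (meson leD leI less_one)
    have e_ge: "g \<le> e z" if "z \<in> Z" "b \<le> z" for z
      unfolding e_def using M1[OF that] by (rule le_nmul_add)
    have not_less1: "\<not> nmul p m + u <\<^sub>1 w"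
      if "p \<in> Class0" "u < p" "1 \<le> m" "\<not> (m = 1 \<and> u = 0)" for p m u w
      using that Class0_nmul_add less1_imp_Lim_pts Lim_pts_Class0 by blast
    have e_less1: "e z <\<^sub>1 e w \<longleftrightarrow> z <\<^sub>1 w" if z: "z \<in> Z" and w: "w \<in> Z" and zw: "z < w" for z w
    proof -
      consider "w < b" | "z < b" "b \<le> w" | "b \<le> z" "M z = 1 \<and> U z = 0"
        | "b \<le> z" "\<not> (M z = 1 \<and> U z = 0)"
        by (meson not_le)
      then show ?thesis
      proof cases
        case 1
        then show ?thesis
          using zw e_id z w by simp
      next
        case 2
        have ez: "e z = z"
          using e_id z 2 by blast
        have "M z = 0"
          using M0 z 2 by blast
        then have "z < g"
          using MU[OF z] Ug[OF z] by simp
        \<comment> \<open>Restrict to \<open>z <\<^sub>1 g\<close>, pass to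
          \<open>z <\<^sub>1 b\<close> by the threshold, and compose with
          \<open>b <\<^sub>1 w\<close>, which is known from the smaller levels. The converse below
          is monotonicity, as \<open>e w \<le> w\<close>.\<close>
        have "z <\<^sub>1 w" if "z <\<^sub>1 e w"
        proof -
          have "z <\<^sub>1 g"
            using that \<open>z < g\<close> e_ge[OF w 2(2)] by (rule less1_mono)
          then have zb: "z <\<^sub>1 b"
            using D(2) Dg z 2 \<open>z < g\<close> by blast
          have "b <\<^sub>1 w" if "b < w"
          proof -
            have "b <\<^sub>1 nmul b (M w) + U w"
            proof (rule reflecting_less1[OF bR])
              show "1 \<le> M w"
                using w 2(2) by (rule M1)
              show "b < nmul b (M w) + U w"
                using that MU[OF w] by simp
              show "nmul b (M w) + U w \<le> nmul b n + s"
                using w Z MU[OF w] by (force simp: t_def)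
            qed
            then show ?thesis
              using MU[OF w] by simp
          qed
          then show ?thesis
            using zb 2(2) less1_trans by (auto simp: le_less)
        qed
        moreover have "z <\<^sub>1 e w" if "z <\<^sub>1 w"
        proof (rule less1_mono[OF that])
          show "z < e w"
            using \<open>z < g\<close> e_ge[OF w 2(2)] by (rule less_le_trans)
          have "e w \<le> nmul b (M w) + U w"
            unfolding e_def using g(3) by (intro ordinal_add_mono_left nmul_mono_left) simp
          then show "e w \<le> w"
            using MU[OF w] by simp
        qed
        ultimately show ?thesis
          unfolding ez by blast
      next
        case 3
        have "z = b"
          using MU[OF z] 3 by simp
        have "e z = g"
          using 3 by (simp add: e_def)
        have Mw: "1 \<le> M w"
          using M1 w 3 zw by simp
        have "g <\<^sub>1 nmul g (M w) + U w"
          using e_less[OF z w] zw e_top[OF w] \<open>e z = g\<close>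
          by (intro reflecting_less1[OF g(1) Mw]) (auto simp: e_def)
        moreover have "b <\<^sub>1 nmul b (M w) + U w"
          using w Z MU[OF w] zw \<open>z = b\<close> by (intro reflecting_less1[OF bR Mw]) (force simp: t_def)+
        ultimately show ?thesis
          using MU[OF w] \<open>z = b\<close> \<open>e z = g\<close> by (simp add: e_def)
      next
        case 4
        have "1 \<le> M z"
          using M1 z 4 by simp
        then have "\<not> nmul g (M z) + U z <\<^sub>1 e w" "\<not> nmul b (M z) + U z <\<^sub>1 w"
          using not_less1[OF gC Ug[OF z]] not_less1[OF bC, of "U z"] 4 MU[OF z] by blast+
        then show ?thesis
          using MU[OF z] by (simp add: e_def)
      qed
    qed
    show "\<exists>h. h ` Z \<subseteq> {..<b} \<and> (\<forall>x\<in>Z \<inter> {..<b}. h x = x) \<and> embeds Z h"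
    proof (intro exI[of _ e] conjI)
      have "e z < b" if "z \<in> Z" for z
        unfolding e_def using that Ug g(3) bC
        by (intro Class0_add Class0_nmul) (auto intro: less_trans)
      then show "e ` Z \<subseteq> {..<b}"
        by blast
      show "\<forall>x\<in>Z \<inter> {..<b}. e x = x"
        using e_id by simp
      show "embeds Z e"
        unfolding embeds_def using e_less e_less1 e_add less1_less by (metis less_asym)
    qed
  qed
  then show ?case
    using n bC sb by (simp add: reflecting_succ_iff t_def add.assoc)
qed

text \<open>Taking limit points raises the remainder by one, which matches the
  \<open>Lim_pts\<close> in each clause of the recursion for \<open>A0\<close>.\<close>

theorem Lim_pts_reflecting: "1 \<le> n \<Longrightarrow> Lim_pts (reflecting n s) = reflecting n (s + 1)"
  using Lim_pts_reflecting_subset_reflecting_succ reflecting_succ_subset_Lim_pts by blast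

section \<open>The classes \<open>A0 t\<close>\<close>

lemma lessThan_add_one: "{..<a + 1} = {..a :: 'a ordinal}"
  by auto

text \<open>For additive principal \<open>p < q\<close> one has \<open>p * \<omega> \<le> q\<close>,
  so the intervals \<open>[p, p\<omega>)\<close> are disjoint.\<close>

lemma lead_eq:
  assumes "a \<in> Class0" "t \<in> {a..<a * \<omega>}"
  shows "lead t = a"
  unfolding lead_def
proof (rule the_equality)
  fix b assume b: "b \<in> Class0 \<and> t \<in> {b..<b * \<omega>}"
  have "\<not> p < q" if "p \<in> Class0" "q \<in> Class0" "q \<le> t" "t < p * \<omega>" for p q
    using Class0_mult_omega_le[OF that(2), of p] that(3,4) by (meson leD order_trans)
  then show "b = a"
    using assms b by (metis atLeastLessThan_iff neqE)
qed (use assms in simp)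

lemma T0_eq:
  assumes "1 \<le> n" "u < a"
  shows "T0 a (nmul a n + u) = {nmul a n + u, u}"
proof -
  let ?t = "nmul a n + u"
  have "(THE k. k \<in> {1..<\<omega>} \<and> ?t \<in> {a * k..<a * k + a}) = nmul 1 n"
  proof (rule the_equality)
    show "nmul 1 n \<in> {1..<\<omega>} \<and> ?t \<in> {a * nmul 1 n..<a * nmul 1 n + a}"
      using assms le_nmul[OF assms(1), of 1] less_omega_iff
      by (auto simp: mult_nmul_one ordinal_add_props(1))
    fix k assume k: "k \<in> {1..<\<omega>} \<and> ?t \<in> {a * k..<a * k + a}"
    then obtain j where j: "k = nmul 1 j"
      by (auto simp: less_omega_iff)
    with k obtain v where v: "?t = nmul a j + v"
      by (auto simp: mult_nmul_one elim: ordinal_le_imp_add)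
    with j k have "v < a"
      by (simp add: mult_nmul_one)
    with v show "k = nmul 1 n"
      using nmul_decomp_eq_iff[OF assms(2), of v n j] j by simp
  qed
  moreover have "left_diff (nmul a n) ?t = u"
    by (simp add: left_diff_def)
  moreover have "\<not> ?t < a"
    using le_nmul_add[OF assms(1)] by (simp add: not_less)
  ultimately show ?thesis
    by (simp add: T0_def mult_nmul_one)
qed

lemma T0_subset_iff:
  assumes "1 \<le> n" "u < a"
  shows "T0 a (nmul a n + u) \<inter> {..<a} \<subseteq> {..<r} \<longleftrightarrow> u < r"
  using assms le_nmul_add[OF assms(1), of a u] by (auto simp: T0_eq)

text \<open>By induction on \<open>nmul a n + s\<close>, each of the three clauses of
  \<open>A0\<close> yields the limit points of \<open>reflecting n s\<close> up to \<open>a\<close>;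
  \<open>Lim_pts_reflecting\<close> then finishes.\<close>

theorem A0_eq:
  assumes "a \<in> Class0" "1 \<le> n" "s < a"
  shows "A0 (nmul a n + s) = reflecting n (s + 1) \<inter> {..a}"
  using assms(2,3)
proof (induction "nmul a n + s" arbitrary: n s rule: less_induct)
  case less
  note n = less.prems(1) and s = less.prems(2)
  define t where "t = nmul a n + s"
  have a: "0 < a" "1 < a"
    using assms(1) by (auto simp: Class0_iff ordinal_pos_iff)
  have at: "a \<le> t" and t_less: "t < a * \<omega>"
    unfolding t_def using le_nmul_add[OF n] nmul_add_less_mult_omega[OF s] by blast+
  then have lead: "lead t = a"
    using assms(1) by (intro lead_eq) auto
  have decomp: "\<exists>m u. 1 \<le> m \<and> u < a \<and> d = nmul a m + u" if "a \<le> d" "d < t" for d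
  proof -
    have "d < a * \<omega>"
      using that(2) t_less by (rule less_trans)
    then obtain m u where mu: "u < a" "d = nmul a m + u"
      by (rule nmul_decomp)
    moreover have "m \<noteq> 0"
      using mu that(1) by (auto intro: ccontr)
    ultimately show ?thesis
      by (metis less_one not_le)
  qed
  have IH: "A0 (nmul a m + u) = reflecting m (u + 1) \<inter> {..a}"
    if "nmul a m + u < t" "1 \<le> m" "u < a" for m u
    using less.hyps that unfolding t_def by blast
  consider "t = a" | l where "t \<noteq> a" "t = l + 1" | "t \<noteq> a" "\<nexists>l. t = l + 1"
    by blast
  then have "A0 t = Lim_pts (reflecting n s) \<inter> {..a}"
  proof cases
    case 1
    then have "n = 1 \<and> s = 0"
      using nmul_decomp_eq_iff[OF s a(1), of n 1] by (simp add: t_def)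
    then have "reflecting n s = Class0"
      using reflecting_one_zero by blast
    then show ?thesis
      by (subst A0.simps) (use 1 lead in \<open>simp add: lessThan_add_one\<close>)
  next
    case 2
    then have "a \<le> l" "l < t"
      using at by (auto simp: le_less)
    then obtain m u where mu: "1 \<le> m" "u < a" "l = nmul a m + u"
      using decomp by blast
    then have "nmul a m + (u + 1) = nmul a n + s"
      using 2 by (simp add: t_def add.assoc)
    then have "m = n \<and> u + 1 = s"
      using mu(2) s by (subst (asm) nmul_decomp_eq_iff) (simp_all add: Class0_add_one[OF assms(1)])
    then have "A0 l = reflecting n s \<inter> {..a}"
      using IH[of m u] mu \<open>l < t\<close> by auto
    moreover have "A0 t = Lim_pts (A0 l)"
      by (subst A0.simps) (use 2 lead in simp)
    ultimately show ?thesis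
      by (simp add: Lim_pts_Int_atMost)
  next
    case 3
    define X where "X = {r \<in> Class0 \<inter> {..<a + 1}. T0 a t \<inter> {..<a} \<subseteq> {..<r} \<and>
       (\<forall>d\<in>{a<..<t}. T0 a d \<inter> {..<a} \<subseteq> {..<r} \<longrightarrow> r \<in> A0 d)}"
    have X_iff: "r \<in> X \<longleftrightarrow> r \<in> Class0 \<and> r \<le> a \<and> s < r \<and>
        (\<forall>m u. 1 \<le> m \<longrightarrow> u < a \<longrightarrow> a < nmul a m + u \<longrightarrow> nmul a m + u < t \<longrightarrow> u < r \<longrightarrow>
          r \<in> reflecting m (u + 1))" for r
    proof -
      have "(\<forall>d\<in>{a<..<t}. T0 a d \<inter> {..<a} \<subseteq> {..<r} \<longrightarrow> r \<in> A0 d) \<longleftrightarrow>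
        (\<forall>m u. 1 \<le> m \<longrightarrow> u < a \<longrightarrow> a < nmul a m + u \<longrightarrow> nmul a m + u < t \<longrightarrow> u < r \<longrightarrow>
          r \<in> reflecting m (u + 1))" (is "?L \<longleftrightarrow> ?R") if "r \<le> a"
      proof
        assume L: ?L
        show ?R
        proof (intro allI impI)
          fix m u assume mu: "1 \<le> m" "u < a" "a < nmul a m + u" "nmul a m + u < t" "u < r"
          then have "r \<in> A0 (nmul a m + u)"
            using L T0_subset_iff[OF mu(1,2), of r] by simp
          then show "r \<in> reflecting m (u + 1)"
            using IH[OF mu(4,1,2)] by blast
        qed
      next
        assume R: ?R
        show ?L
        proof (intro ballI impI)
          fix d assume d: "d \<in> {a<..<t}" "T0 a d \<inter> {..<a} \<subseteq> {..<r}"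
          then obtain m u where mu: "1 \<le> m" "u < a" "d = nmul a m + u"
            using decomp[of d] by (auto simp: less_imp_le)
          then have "r \<in> reflecting m (u + 1)"
            using R d T0_subset_iff[OF mu(1,2), of r] by simp
          then show "r \<in> A0 d"
            using IH[of m u] mu d(1) that by auto
        qed
      qed
      then show ?thesis
        unfolding X_def t_def using T0_subset_iff[OF n s] by (auto simp: t_def)
    qed
    have "X = reflecting n s \<inter> {..a}"
    proof (intro equalityI subsetI)
      fix r assume "r \<in> X"
      then have r: "r \<in> Class0" "r \<le> a" "s < r"
        and refl: "\<And>m u. 1 \<le> m \<Longrightarrow> u < a \<Longrightarrow> a < nmul a m + u \<Longrightarrow> nmul a m + u < t \<Longrightarrow> u < r \<Longrightarrow>
          r \<in> reflecting m (u + 1)"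
        by (auto simp: X_iff)
      have "r \<in> reflecting n s"
        using r(1,3) n
      proof (rule reflecting_limitI)
        fix m u assume m: "1 \<le> m" and u: "u < r" and mu: "nmul r m + u < nmul r n + s"
        have ua: "u < a"
          using u r(2) by (rule less_le_trans)
        have less: "nmul a m + u < t"
          using mu nmul_decomp_less_iff[OF u r(3), of m n] nmul_decomp_less_iff[OF ua s, of m n]
          by (simp add: t_def)
        show "r \<in> reflecting m (u + 1)"
        proof (cases "a < nmul a m + u")
          case True
          then show ?thesis
            using refl m ua less u by blast
        next
          case False
          then have "nmul a m + u = nmul a 1 + 0"
            using le_nmul_add[OF m, of a u] by simp
          then have mu: "m = 1" "u = 0"
            using nmul_decomp_eq_iff[OF ua a(1), of m 1] by auto
          \<comment> \<open>The level of \<open>a\<close> itself lies outside the open interval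
            \<open>(a, t)\<close>. It is recovered from that of \<open>a + 1\<close>, which is below
            \<open>t\<close> because \<open>t\<close> is not a successor.\<close>
          have "a + 1 < t"
            using at 3 by (metis le_less ordinal_add_one_le)
          moreover have "1 < r"
            using r(1) by (simp add: Class0_iff)
          ultimately have "r \<in> reflecting 1 (1 + 1)"
            using a(2) by (intro refl) auto
          then have "r \<in> reflecting 1 1"
            by (rule reflecting_mono) (use \<open>1 < r\<close> in \<open>auto simp: ordinal_add_props(1)\<close>)
          then show ?thesis
            using mu by (simp add: ordinal_zero_add)
        qed
      qed
      with r show "r \<in> reflecting n s \<inter> {..a}"
        by simp
    next
      fix r assume "r \<in> reflecting n s \<inter> {..a}"
      then have r: "r \<in> reflecting n s" "r \<le> a" "r \<in> Class0" "s < r"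
        using reflecting_Class0 reflecting_less by blast+
      have "r \<in> reflecting m (u + 1)"
        if m: "1 \<le> m" and u: "u < r" and mu: "nmul a m + u < t" for m u
      proof (rule reflecting_mono[OF r(1) m])
        show "u + 1 < r"
          using u Class0_add_one[OF r(3)] by blast
        have "nmul r m + u < nmul r n + s"
          using mu nmul_decomp_less_iff[OF u r(4), of m n]
            nmul_decomp_less_iff[OF less_le_trans[OF u r(2)] s, of m n]
          by (simp add: t_def)
        then show "nmul r m + (u + 1) \<le> nmul r n + s"
          by (simp flip: add.assoc)
      qed
      then show "r \<in> X"
        using r by (simp add: X_iff)
    qed
    moreover have "A0 t = Lim_pts X"
      by (subst A0.simps) (use 3 lead in \<open>simp add: X_def\<close>)
    ultimately show ?thesis
      by (simp add: Lim_pts_Int_atMost)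
  qed
  then show ?case
    by (simp add: t_def Lim_pts_reflecting[OF n])
qed

section \<open>From the finite levels to \<open>g <\<^sub>1 g * \<omega>\<close>\<close>

lemma less1_mult_omegaI:
  assumes g: "g \<in> Class0" and refl: "\<And>n. 1 \<le> n \<Longrightarrow> g \<in> reflecting n (0 + 1)"
  shows "g <\<^sub>1 g * \<omega>"
proof (rule less1_limitI)
  show "g < g * \<omega>"
    using Class0_pos[OF g] by (rule less_mult_omega)
  fix d assume d: "g \<le> d" "d < g * \<omega>"
  then obtain n where n: "d < nmul g n"
    by (auto simp: less_mult_omega_iff)
  then have "1 \<le> n"
    by (cases n) auto
  then have "g <\<^sub>1 nmul g n + (0 + 1)"
    using refl reflecting_succ_iff by blast
  then show "g <\<^sub>1 d + 1"
    by (rule less1_mono) (use d n in \<open>auto simp: ordinal_zero_add less_imp_le\<close>)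
qed

lemma less1_mult_omega_reflecting:
  assumes g: "g \<in> Class0" "g <\<^sub>1 g * \<omega>" and n: "1 \<le> n" and s: "s < g"
  shows "g \<in> reflecting n (s + 1)"
proof -
  have "g <\<^sub>1 nmul g n + (s + 1)"
  proof (rule less1_mono[OF g(2)])
    show "g < nmul g n + (s + 1)"
      using le_nmul_add[OF n, of g s] by (simp flip: add.assoc)
    show "nmul g n + (s + 1) \<le> g * \<omega>"
      using s by (intro less_imp_le nmul_add_less_mult_omega) (simp add: Class0_add_one[OF g(1)])
  qed
  then show ?thesis
    using g n s by (simp add: reflecting_succ_iff)
qed

text \<open>The set is contained in \<open>reflecting n 0\<close> for every
  \<open>n \<ge> 1\<close>, so its limit points are in every \<open>reflecting n 1\<close>, and
  these suffice by continuity.\<close>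

lemma Lim_pts_less1_mult_omega:
  "Lim_pts {g \<in> Class0. g <\<^sub>1 g * \<omega>} \<subseteq> {g \<in> Class0. g <\<^sub>1 g * \<omega>}"
proof
  let ?C = "{g \<in> Class0. g <\<^sub>1 g * \<omega>}"
  fix b assume b: "b \<in> Lim_pts ?C"
  have "?C \<subseteq> reflecting n 0" if "1 \<le> n" for n
  proof
    fix g assume g: "g \<in> ?C"
    then have "g \<in> reflecting n (0 + 1)"
      using that by (intro less1_mult_omega_reflecting) (auto simp: Class0_pos)
    then show "g \<in> reflecting n 0"
      using that g by (rule_tac reflecting_mono) (auto simp: Class0_pos ordinal_add_props(1))
  qed
  then have "b \<in> reflecting n (0 + 1)" if "1 \<le> n" for n
    using b that Lim_pts_reflecting[OF that, of 0] Lim_pts_mono by blast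
  moreover from this[of 1] have "b \<in> Class0"
    using reflecting_Class0 by blast
  ultimately show "b \<in> ?C"
    using less1_mult_omegaI by blast
qed

section \<open>Regular uncountable ordinals\<close>

text \<open>A map from a proper initial segment into \<kappa> is not cofinal, and an ordinal that it
  fails to reach is a strict bound.\<close>

lemma regular_bound:
  assumes "regular_ordinal \<kappa>" "b < \<kappa>" "\<And>x. x < b \<Longrightarrow> f x < \<kappa>"
  shows "\<exists>y<\<kappa>. \<forall>x<b. f x < y"
proof -
  have "b < cofinality \<kappa>"
    using assms(1,2) by (simp add: regular_ordinal_def)
  then have "\<not> (\<exists>f. f ` {..<b} \<subseteq> {..<\<kappa>} \<and> (\<forall>\<xi><\<kappa>. \<exists>\<eta><b. \<xi> \<le> f \<eta>))"
    unfolding cofinality_def by (rule not_less_Least)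
  then have "\<not> (\<forall>\<xi><\<kappa>. \<exists>\<eta><b. \<xi> \<le> f \<eta>)"
    using assms(3) by (metis image_subsetI lessThan_iff)
  then show ?thesis
    by (meson not_le)
qed

lemma inj_nmul_one: "inj (nmul (1 :: 'a ordinal))"
  using nmul_decomp_eq_iff[of "0 :: 'a ordinal" 1 0] by (auto simp: inj_def)

lemma omega_less_uncountable:
  assumes "uncountable {..<\<kappa> :: 'a ordinal}"
  shows "\<omega> < \<kappa>"
proof (rule ccontr)
  assume "\<not> \<omega> < \<kappa>"
  then have "{..<\<kappa>} \<subseteq> range (nmul 1)"
    by (auto simp: not_less image_iff simp flip: less_omega_iff)
  then have "countable {..<\<kappa>}"
    by (rule countable_subset) simp
  then show False
    using assms by simp
qed

text \<open>Uncountability gives \<open>\<omega> < \<kappa>\<close>; the inverse of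
  \<open>nmul 1\<close> turns the sequence into a map on \<omega>, to which
  \<open>regular_bound\<close> applies.\<close>

lemma regular_bound_nat:
  fixes f :: "nat \<Rightarrow> 'a ordinal"
  assumes "regular_ordinal \<kappa>" "uncountable {..<\<kappa>}" "\<And>i. f i < \<kappa>"
  shows "\<exists>y<\<kappa>. \<forall>i. f i < y"
proof -
  have "\<exists>y<\<kappa>. \<forall>x<\<omega>. f (inv (nmul (1 :: 'a ordinal)) x) < y"
    by (rule regular_bound[OF assms(1) omega_less_uncountable[OF assms(2)],
          of "\<lambda>x. f (inv (nmul 1) x)"]) (rule assms(3))
  then show ?thesis
    by (metis inj_nmul_one inv_f_f less_omega_iff)
qed

lemma regular_Class0:
  assumes "regular_ordinal \<kappa>" "uncountable {..<\<kappa>}"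
  shows "\<kappa> \<in> Class0"
proof -
  have "1 \<le> (\<omega> :: 'a ordinal)"
    by (rule one_le_omega)
  then have "1 < \<kappa>"
    using omega_less_uncountable[OF assms(2)] by (rule le_less_trans)
  moreover have "a + b < \<kappa>" if "a < \<kappa>" "b < \<kappa>" for a b
    using that(2)
  proof (induction b rule: less_induct)
    case (less b)
    then have "\<And>c. c < b \<Longrightarrow> a + c < \<kappa>"
      using less_trans by blast
    then obtain y where y: "y < \<kappa>" "\<forall>c<b. a + c < y"
      using regular_bound[OF assms(1) less.prems, of "(+) a"] by blast
    have "a + b \<le> max a y"
      by (rule ordinal_add_props(3)) (use y in \<open>auto simp: less_max_iff_disj\<close>)
    also have "\<dots> < \<kappa>"
      using that(1) y(1) by simp
    finally show ?case .
  qed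
  ultimately show ?thesis
    by (simp add: Class0_iff)
qed

section \<open>Unboundedness below a regular uncountable ordinal\<close>

definition unbounded_in :: "'a ordinal set \<Rightarrow> 'a ordinal \<Rightarrow> bool" where
  "unbounded_in A \<kappa> \<longleftrightarrow> (\<forall>x<\<kappa>. \<exists>a\<in>A. x < a \<and> a < \<kappa>)"

lemma Class0_unbounded_in:
  assumes "regular_ordinal \<kappa>" "uncountable {..<\<kappa>}"
  shows "unbounded_in Class0 \<kappa>"
  unfolding unbounded_in_def
proof (intro allI impI)
  fix x assume "x < \<kappa>"
  then have "x + 1 < \<kappa>"
    using Class0_add_one[OF regular_Class0[OF assms]] by blast
  then obtain y where y: "y < \<kappa>" "\<forall>i. nmul (x + 1) i < y"
    using regular_bound_nat[OF assms, of "nmul (x + 1)"] Class0_nmul[OF regular_Class0[OF assms]]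
    by blast
  then have "(x + 1) * \<omega> \<le> y"
    by (meson leI less_asym less_mult_omega_iff)
  moreover have "x + 1 < (x + 1) * \<omega>"
    by (rule less_mult_omega) (simp add: ordinal_pos_iff)
  ultimately show "\<exists>a\<in>Class0. x < a \<and> a < \<kappa>"
    using y(1) by (intro bexI[of _ "(x + 1) * \<omega>"] conjI mult_omega_Class0)
      (auto simp: ordinal_pos_iff intro: less_trans[of x "x + 1"])
qed

text \<open>
  The supremum of an \<open>\<omega>\<close>-sequence closed off under witnesses.  This replaces diagonal intersections
  of closed unbounded sets.
\<close>

lemma diagonal_Lim_pts:
  fixes E :: "nat \<Rightarrow> 'a ordinal \<Rightarrow> 'a ordinal set"
  assumes reg: "regular_ordinal \<kappa>" "uncountable {..<\<kappa>}"
    and E: "\<And>i s. s < \<kappa> \<Longrightarrow> unbounded_in (E i s) \<kappa>" and d: "d < \<kappa>"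
  obtains g where "d < g" "g < \<kappa>" "\<And>i s. s < g \<Longrightarrow> g \<in> Lim_pts (E i s)"
proof -
  have "\<forall>i s x. \<exists>w. s < \<kappa> \<longrightarrow> x < \<kappa> \<longrightarrow> w \<in> E i s \<and> x < w \<and> w < \<kappa>"
    using E unfolding unbounded_in_def by blast
  then obtain W where W: "\<And>i s x. s < \<kappa> \<Longrightarrow> x < \<kappa> \<Longrightarrow> W i s x \<in> E i s \<and> x < W i s x \<and> W i s x < \<kappa>"
    by metis
  \<comment> \<open>One closing-off step: bound the witnesses over \<open>s < x\<close> by
    regularity for each \<open>i\<close>, then bound the resulting sequence over all
    \<open>i\<close>.\<close>
  have "\<exists>y<\<kappa>. x < y \<and> (\<forall>i. \<forall>s<x. W i s x < y)" if x: "x < \<kappa>" for x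
  proof -
    have "\<exists>z<\<kappa>. \<forall>s<x. W i s x < z" for i
      using W x less_trans[OF _ x] by (intro regular_bound[OF reg(1) x]) blast
    then obtain Y where Y: "\<And>i. Y i < \<kappa> \<and> (\<forall>s<x. W i s x < Y i)"
      by metis
    then obtain y where y: "y < \<kappa>" "\<forall>i. Y i < y"
      using regular_bound_nat[OF reg, of Y] by blast
    have "x + 1 < \<kappa>"
      using x Class0_add_one[OF regular_Class0[OF reg]] by blast
    then show ?thesis
      using Y y by (intro exI[of _ "max (x + 1) y"]) (auto simp: less_max_iff_disj intro: less_trans)
  qed
  then obtain N where N: "\<And>x. x < \<kappa> \<Longrightarrow> N x < \<kappa> \<and> x < N x \<and> (\<forall>i. \<forall>s<x. W i s x < N x)"
    by metis
  define F where "F k = (N ^^ k) d" for k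
  have F_Suc: "F (Suc k) = N (F k)" for k
    by (simp add: F_def)
  have F: "F k < \<kappa>" for k
    by (induction k) (use d N in \<open>auto simp: F_def\<close>)
  obtain y where y: "y < \<kappa>" "\<forall>k. F k < y"
    using regular_bound_nat[OF reg, of F] F by blast
  define g where "g = (LEAST y. \<forall>k. F k < y)"
  have Fg: "F k < g" for k
    using LeastI[of "\<lambda>y. \<forall>k. F k < y", OF y(2)] by (simp add: g_def)
  have "g \<le> y"
    unfolding g_def using y(2) by (rule Least_le)
  have below: "\<exists>k. x \<le> F k" if "x < g" for x
    using that not_less_Least[of x "\<lambda>y. \<forall>k. F k < y"] by (auto simp: g_def not_less)
  show thesis
  proof (rule that)
    show "d < g"
      using Fg[of 0] by (simp add: F_def)
    show "g < \<kappa>"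
      using \<open>g \<le> y\<close> y(1) by (rule le_less_trans)
    fix i s assume s: "s < g"
    have "\<exists>a\<in>E i s. x < a \<and> a < g" if x: "x < g" for x
    proof -
      obtain k where k: "max s x \<le> F k"
        using below[of "max s x"] s x by auto
      \<comment> \<open>Going one index further makes \<open>s < z\<close> strict, so that
        \<open>W i s z\<close> is among the witnesses bounded by \<open>N z\<close>.\<close>
      define z where "z = F (Suc k)"
      have "F k < z"
        using N F by (simp add: z_def F_Suc)
      then have z: "s < z" "x < z" "z < \<kappa>"
        using k F by (auto simp: z_def)
      then have w: "W i s z \<in> E i s" "z < W i s z"
        using W less_trans[OF z(1,3)] by blast+
      have "W i s z < F (Suc (Suc k))"
        using N[OF z(3)] z(1) by (simp add: z_def F_Suc)
      then show ?thesis
        using w z Fg less_trans by blast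
    qed
    then show "g \<in> Lim_pts (E i s)"
      using s by (auto simp: Lim_pts_iff)
  qed
qed

lemma reflecting_unbounded_in:
  assumes reg: "regular_ordinal \<kappa>" "uncountable {..<\<kappa>}" and "1 \<le> n" "s < \<kappa>"
  shows "unbounded_in (reflecting n s) \<kappa>"
  using assms(3,4)
proof (induction "nmul \<kappa> n + s" arbitrary: n s rule: less_induct)
  case less
  \<comment> \<open>Indices not covered by the induction hypothesis get \<open>Class0\<close>, so
    all sets are unbounded. The entry at \<open>(0, 0)\<close> also yields that \<open>g\<close> is
    additive principal.\<close>
  define E where "E m u =
    (if 1 \<le> m \<and> nmul \<kappa> m + u < nmul \<kappa> n + s then reflecting m u else Class0)" for m u
  have E: "unbounded_in (E m u) \<kappa>" if "u < \<kappa>" for m u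
    using less.hyps[of m u] that Class0_unbounded_in[OF reg] by (simp add: E_def)
  show ?case
    unfolding unbounded_in_def
  proof (intro allI impI)
    fix x assume "x < \<kappa>"
    then have "max x s < \<kappa>"
      using less.prems by simp
    then obtain g where g: "max x s < g" "g < \<kappa>" "\<And>m u. u < g \<Longrightarrow> g \<in> Lim_pts (E m u)"
      using diagonal_Lim_pts[of \<kappa> E, OF reg E] by blast
    have sg: "s < g" "x < g"
      using g(1) by simp_all
    have "0 < g"
      using g(1) by (metis ordinal_pos_iff ordinal_not_less_zero)
    then have gC: "g \<in> Class0"
      using g(3)[of 0 0] Lim_pts_Class0 by (auto simp: E_def)
    have "g \<in> reflecting n s"
      using gC sg(1) less.prems(1)
    proof (rule reflecting_limitI)
      fix m u assume m: "1 \<le> m" and u: "u < g" and mu: "nmul g m + u < nmul g n + s"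
      have "nmul \<kappa> m + u < nmul \<kappa> n + s"
        using mu nmul_decomp_less_iff[OF u sg(1), of m n]
          nmul_decomp_less_iff[OF less_trans[OF u g(2)] less.prems(2), of m n] by simp
      then have "g \<in> Lim_pts (reflecting m u)"
        using g(3)[OF u, of m] m by (simp add: E_def)
      then show "g \<in> reflecting m (u + 1)"
        using Lim_pts_reflecting[OF m] by blast
    qed
    then show "\<exists>a\<in>reflecting n s. x < a \<and> a < \<kappa>"
      using sg g(2) by blast
  qed
qed

lemma less1_mult_omega_unbounded_in:
  assumes reg: "regular_ordinal \<kappa>" "uncountable {..<\<kappa>}"
  shows "unbounded_in {g \<in> Class0. g <\<^sub>1 g * \<omega>} \<kappa>"
  unfolding unbounded_in_def
proof (intro allI impI)
  fix x assume x: "x < \<kappa>"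
  have E: "unbounded_in (reflecting (Suc i) 0) \<kappa>" for i
    using Class0_pos[OF regular_Class0[OF reg]] by (intro reflecting_unbounded_in[OF reg]) auto
  obtain g where g: "x < g" "g < \<kappa>"
    "\<And>(i::nat) s. s < g \<Longrightarrow> g \<in> Lim_pts (reflecting (Suc i) 0)"
    \<comment> \<open>The family is constant in \<open>s\<close>, so the diagonal argument here
      meets the countably many levels at once; \<open>Suc i\<close> runs through the
      \<open>n \<ge> 1\<close>.\<close>
    using diagonal_Lim_pts[of \<kappa> "\<lambda>i s. reflecting (Suc i) 0", OF reg E x] by blast
  have refl: "g \<in> reflecting n (0 + 1)" if "1 \<le> n" for n
    using g(3)[OF g(1), of "n - 1"] that unfolding Lim_pts_reflecting[OF that, symmetric] by simp
  then have "g \<in> Class0"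
    using reflecting_Class0 by blast
  then have "g <\<^sub>1 g * \<omega>"
    using refl by (rule less1_mult_omegaI)
  then show "\<exists>a\<in>{g \<in> Class0. g <\<^sub>1 g * \<omega>}. x < a \<and> a < \<kappa>"
    using \<open>g \<in> Class0\<close> g(1,2) by blast
qed

theorem proposition16:
  fixes \<kappa> \<alpha> :: "'a ordinal"
  assumes "regular_ordinal \<kappa>" and "uncountable {..<\<kappa>}"
    and "\<alpha> = Inf Class0"
  shows "\<Inter>{A0 t |t. t \<in> {\<kappa>..<\<kappa> * \<omega>} \<and> T0 \<kappa> t \<inter> {..<\<kappa>} \<subseteq> {..<\<alpha>}} =
           {\<gamma> \<in> Class0 \<inter> {..<\<kappa> + 1}. \<gamma> <\<^sub>1 \<gamma> * \<omega>} \<and>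
         closed_unbounded_in {\<gamma> \<in> Class0. \<gamma> <\<^sub>1 \<gamma> * \<omega>} \<kappa>"
proof
  let ?C = "{\<gamma> \<in> Class0. \<gamma> <\<^sub>1 \<gamma> * \<omega>}"
  have \<kappa>: "\<kappa> \<in> Class0"
    using assms(1,2) by (rule regular_Class0)
  have \<alpha>: "0 < \<alpha>" "\<And>g. g \<in> Class0 \<Longrightarrow> \<alpha> \<le> g"
  proof -
    show "0 < \<alpha>"
      unfolding assms(3) Inf_Class0 ordinal_pos_iff
      using limit_ordinal_omega limit_ordinal_def by blast
    show "\<alpha> \<le> g" if "g \<in> Class0" for g
      unfolding assms(3) using that by (rule cInf_lower) (rule bdd_belowI[of _ 0], simp)
  qed
  show "\<Inter>{A0 t |t. t \<in> {\<kappa>..<\<kappa> * \<omega>} \<and> T0 \<kappa> t \<inter> {..<\<kappa>} \<subseteq> {..<\<alpha>}} =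
           {\<gamma> \<in> Class0 \<inter> {..<\<kappa> + 1}. \<gamma> <\<^sub>1 \<gamma> * \<omega>}"
  proof (intro equalityI subsetI)
    fix g assume g: "g \<in> \<Inter>{A0 t |t. t \<in> {\<kappa>..<\<kappa> * \<omega>} \<and> T0 \<kappa> t \<inter> {..<\<kappa>} \<subseteq> {..<\<alpha>}}"
    \<comment> \<open>Take \<open>t = \<kappa>n\<close>: its only element of \<open>T0\<close> below
      \<kappa> is 0, which is less than \<alpha>.\<close>
    have "g \<in> reflecting n (0 + 1) \<inter> {..\<kappa>}" if n: "1 \<le> n" for n
    proof -
      have "nmul \<kappa> n + 0 \<in> {\<kappa>..<\<kappa> * \<omega>}"
        using le_nmul_add[OF n] nmul_add_less_mult_omega[OF Class0_pos[OF \<kappa>]]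
        unfolding atLeastLessThan_iff by blast
      moreover have "T0 \<kappa> (nmul \<kappa> n + 0) \<inter> {..<\<kappa>} \<subseteq> {..<\<alpha>}"
        using T0_subset_iff[OF n Class0_pos[OF \<kappa>]] \<alpha>(1) by blast
      ultimately have "g \<in> A0 (nmul \<kappa> n + 0)"
        using g by blast
      then show ?thesis
        using A0_eq[OF \<kappa> n Class0_pos[OF \<kappa>]] by blast
    qed
    then show "g \<in> {\<gamma> \<in> Class0 \<inter> {..<\<kappa> + 1}. \<gamma> <\<^sub>1 \<gamma> * \<omega>}"
      unfolding lessThan_add_one using less1_mult_omegaI[of g] reflecting_Class0 by blast
  next
    fix g assume "g \<in> {\<gamma> \<in> Class0 \<inter> {..<\<kappa> + 1}. \<gamma> <\<^sub>1 \<gamma> * \<omega>}"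
    then have g: "g \<in> Class0" "g <\<^sub>1 g * \<omega>" "g \<le> \<kappa>"
      by (auto simp: lessThan_add_one)
    have "g \<in> A0 t" if t: "\<kappa> \<le> t" "t < \<kappa> * \<omega>" "T0 \<kappa> t \<inter> {..<\<kappa>} \<subseteq> {..<\<alpha>}" for t
    proof -
      obtain n s where ns: "s < \<kappa>" "t = nmul \<kappa> n + s"
        using t(2) by (rule nmul_decomp)
      have n: "1 \<le> n"
        using ns t(1) by (cases n) auto
      have "s < \<alpha>"
        using t(3) T0_subset_iff[OF n ns(1)] ns(2) by blast
      then have "s < g"
        using \<alpha>(2)[OF g(1)] by (rule less_le_trans)
      then show ?thesis
        using less1_mult_omega_reflecting[OF g(1,2) n] A0_eq[OF \<kappa> n ns(1)] ns(2) g(3) by simp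
    qed
    then show "g \<in> \<Inter>{A0 t |t. t \<in> {\<kappa>..<\<kappa> * \<omega>} \<and> T0 \<kappa> t \<inter> {..<\<kappa>} \<subseteq> {..<\<alpha>}}"
      by auto
  qed
  show "closed_unbounded_in ?C \<kappa>"
    unfolding closed_unbounded_in_def
  proof (intro conjI allI impI)
    fix S assume S: "S \<noteq> {} \<and> S \<subseteq> ?C \<inter> {..<\<kappa>} \<and> Sup S < \<kappa>"
    then have bdd: "bdd_above S"
      by (intro bdd_aboveI[of _ \<kappa>]) (auto intro: less_imp_le)
    have S': "S \<subseteq> ?C" "S \<noteq> {}"
      using S by blast+
    show "Sup S \<in> ?C"
    proof (cases "Sup S \<in> S")
      case True
      then show ?thesis using S'(1) by blast
    next
      case False
      have "a < Sup S" if "a \<in> S" for a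
        using cSup_upper[OF that bdd] False that by (auto simp: le_less)
      then have "\<exists>a\<in>?C. x < a \<and> a < Sup S" if "x < Sup S" for x
        using that S'(1) unfolding less_cSup_iff[OF S'(2) bdd] by blast
      moreover have "Sup S \<noteq> 0"
        using S'(2) \<open>\<And>a. a \<in> S \<Longrightarrow> a < Sup S\<close> by fastforce
      ultimately have "Sup S \<in> Lim_pts ?C"
        unfolding Lim_pts_iff by blast
      then show ?thesis
        using Lim_pts_less1_mult_omega by blast
    qed
  next
    fix x assume "x < \<kappa>"
    then show "\<exists>g\<in>?C \<inter> {..<\<kappa>}. x < g"
      using less1_mult_omega_unbounded_in[OF assms(1,2)] unfolding unbounded_in_def by blast
  qed
qed

end
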